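(* Let $F$ be an imaginary quadratic field, $L$ a Hermitian lattice of signature $(1,n)$ over $\mathcal{O}_F$ with $n>1$, and $L_Q$ the associated quadratic lattice. Let $\Gamma_O\subset \mathrm{O}^+(L_Q)(\mathbb{Z})$ be a finite index subgroup and let $\Gamma_U=\iota^{-1}(\Gamma_O)\subset\mathrm{U}(L)(\mathbb{Z})$ be its restriction to the unitary group. A cusp of $D_L$ (a rank 1 primitive isotropic sublattice $I\subset L$) maps to the 1-dimensional cusp $I_Q\subset L_Q$ of $\mathcal{D}_{L_Q}$. With types on $D_L$ taken with respect to $\Gamma_U$ and types on $\mathcal{D}_{L_Q}$ taken with respect to $\Gamma_O$: (1) For any imaginary quadratic field $F$, regular cusps on $D_L$ map to regular cusps on $\mathcal{D}_{L_Q}$. (2) For $F\ne\mathbb{Q}(\sqrt{-1}),\mathbb{Q}(\sqrt{-3})$, irregular cusps on $D_L$ map to irregular cusps on $\mathcal{D}_{L_Q}$. (3) For $F=\mathbb{Q}(\sqrt{-1})$, irregular cusps with index $2$ or $4$ on $D_L$ map to irregular cusps with index $2$ on $\mathcal{D}_{L_Q}$, and semi-irregular cusps with index $2$ on $D_L$ map to regular cusps on $\mathcal{D}_{L_Q}$. (4) For $F=\mathbb{Q}(\sqrt{-3})$, irregular cusps with index $2$ or $6$ and semi-irregular cusps with index $2$ on $D_L$ map to irregular cusps with index $2$ on $\mathcal{D}_{L_Q}$, and irregular cusps with index $3$ and semi-irregular cusps with index $3$ on $D_L$ map to regular cusps on $\mathcal{D}_{L_Q}$.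
   Context: Setting. $F=\mathbb{Q}(\sqrt d)$ with $d<0$ square-free. Put $\kappa=1/\sqrt d$ if $d\equiv 1 \bmod 4$ and $\kappa=1/(2\sqrt d)$ otherwise. A Hermitian lattice $(L,\langle\ ,\ \rangle)$ over $\mathcal{O}_F$ carries a non-degenerate Hermitian form $L\times L\to\kappa\mathcal{O}_F$, linear in the first and conjugate linear in the second argument; $V=L\otimes_{\mathcal{O}_F}F$; $\mathrm{U}(L)$ is the unitary group scheme over $\mathbb{Z}$; $D_L=\{[v]\in\mathbb{P}(L\otimes_{\mathcal{O}_F}\mathbb{C})\mid\langle v,v\rangle>0\}$. The associated quadratic lattice $(L_Q,(\ ,\ ))$ of signature $(2,2n)$ is $L$ regarded as a $\mathbb{Z}$-module with $(\ ,\ )=\mathrm{Tr}_{F/\mathbb{Q}}\langle\ ,\ \rangle$, and $\mathcal{D}_{L_Q}$ is a connected component of $\{[v]\in\mathbb{P}(L_Q\otimes_{\mathbb{Z}}\mathbb{C})\mid(v,v)=0,(v,\overline v)>0\}$, $\mathrm{O}^+(L_Q)$ being the subgroup of $\mathrm{O}(L_Q)$ preserving it. There are natural embeddings $D_L\hookrightarrow\mathcal{D}_{L_Q}$ and $\iota:\mathrm{U}(L)\hookrightarrow\mathrm{O}^+(L_Q)$. The image $I_Q$ of $I$ is $I$ regarded as a rank 2 primitive isotropic $\mathbb{Z}$-sublattice of $L_Q$. Unitary types with respect to $\Gamma=\Gamma_U$. $Z(I)_{\mathbb{Q}}$ is the subgroup of $\mathrm{U}(L)(\mathbb{Q})$ of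 elements that stabilize $I_F=I\otimes_{\mathcal{O}_F}F$ and act trivially on $I^\perp\subset V$; it is the center of the unipotent radical of the stabilizer of $I_F$. Let $\omega$ be a primitive cube root of unity. If $F=\mathbb{Q}(\sqrt{-1})$: $I$ is semi-irregular with index 2 if $-\mathrm{id}\in\Gamma$, $\sqrt{-1}\,\mathrm{id}\notin\Gamma$ and $\sqrt{-1}\,T\in\Gamma$ for some $T\in Z(I)_{\mathbb{Q}}$; irregular with index 4 if $-\mathrm{id},\sqrt{-1}\,\mathrm{id}\notin\Gamma$ and $-\sqrt{-1}\,T\in\Gamma$ for some $T\in Z(I)_{\mathbb{Q}}$; irregular with index 2 if $-\mathrm{id}\notin\Gamma$, $-T\in\Gamma$ for some $T\in Z(I)_{\mathbb{Q}}$, and $I$ is not irregular with index 4. If $F=\mathbb{Q}(\sqrt{-3})$: $I$ is semi-irregular with index 2 if $\omega\,\mathrm{id}\in\Gamma$, $-\mathrm{id}\notin\Gamma$ and $-T\in\Gamma$ for some $T\in Z(I)_{\mathbb{Q}}$; semi-irregular with index 3 if $-\mathrm{id}\in\Gamma$, $\omega\,\mathrm{id}\notin\Gamma$ and $\omega T\in\Gamma$ for some $T\in Z(I)_{\mathbb{Q}}$; irregular with index 6 if $-\mathrm{id},\omega\,\mathrm{id}\notin\Gamma$ and $-\omega T\in\Gamma$ for some $T\in Z(I)_{\mathbb{Q}}$; irregular with index 3 if $-\mathrm{id},\omega\,\mathrm{id}\notin\Gamma$, $\omega T\in\Gamma$ for some $T\in Z(I)_{\mathbb{Q}}$, and $I$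 is not irregular with index 6; irregular with index 2 if $-\mathrm{id}\notin\Gamma$, $-T\in\Gamma$ for some $T\in Z(I)_{\mathbb{Q}}$, and $I$ is neither semi-irregular with index 2 nor irregular with index 6. For all other $F$: $I$ is irregular (with index 2) if $-\mathrm{id}\notin\Gamma$ and $-T\in\Gamma$ for some $T\in Z(I)_{\mathbb{Q}}$. $I$ is regular if it is neither irregular nor semi-irregular. Orthogonal types (Ma). For a rank 2 primitive isotropic sublattice $J\subset L_Q$, let $Z(J)_{\mathbb{Q}}$ be the center of the unipotent radical of the stabilizer of $J_{\mathbb{Q}}$ in $\mathrm{O}^+((L_Q)_{\mathbb{Q}})$. $J$ is irregular (with index 2) with respect to $\Gamma_O$ if $-\mathrm{id}\notin\Gamma_O$ and $-T\in\Gamma_O$ for some $T\in Z(J)_{\mathbb{Q}}$; otherwise it is regular. *)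

theory Defs
  imports
    "HOL-Analysis.Analysis"
    "HOL-Computational_Algebra.Computational_Algebra"
    "HOL-Algebra.Coset"
begin

section \<open>Imaginary quadratic fields\<close>

text \<open>The field and its ring of integers are subsets of the complex numbers, so the nontrivial
  automorphism is \<open>cnj\<close>.\<close>

definition quad_field :: "int \<Rightarrow> complex set" where
  "quad_field d = {of_rat a + of_rat b * csqrt (of_int d) | a b. True}"

definition quad_integers :: "int \<Rightarrow> complex set" where
  "quad_integers d = {x \<in> quad_field d. algebraic_int x}"

definition kappa :: "int \<Rightarrow> complex" where
  "kappa d = (if d mod 4 = 1 then 1 / csqrt (of_int d) else 1 / (2 * csqrt (of_int d)))"


section \<open>Lattices\<close>

text \<open>All modules live in the complex space \<open>complex ^ 'n\<close>, which plays the role of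
  \<open>L \<otimes> \<complex>\<close> (over the ring of integers) and, viewed as a real vector space, of the tensor product
  of the \<open>\<int>\<close>-module underlying \<open>L\<close> with the reals. For a subring \<open>R\<close> of the complex numbers,
  \<open>submodule_over R hull S\<close> is the \<open>R\<close>-submodule generated by \<open>S\<close>. In particular, for a
  sublattice \<open>I\<close> of \<open>L\<close>, \<open>submodule_over (quad_field d) hull I\<close> is \<open>I \<otimes> F\<close>, and
  \<open>submodule_over \<rat> hull I\<close> is \<open>I \<otimes> \<rat>\<close>.\<close>

definition submodule_over :: "complex set \<Rightarrow> (complex ^ 'n) set \<Rightarrow> bool" where
  "submodule_over R M \<longleftrightarrow>
     0 \<in> M \<and> (\<forall>x\<in>M. \<forall>y\<in>M. x + y \<in> M) \<and> (\<forall>r\<in>R. \<forall>x\<in>M. r *s x \<in> M)"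

text \<open>The quotient of \<open>L\<close> by \<open>I\<close> is a torsion-free \<open>R\<close>-module.\<close>

definition primitive_in :: "complex set \<Rightarrow> (complex ^ 'n) set \<Rightarrow> (complex ^ 'n) set \<Rightarrow> bool" where
  "primitive_in R L I \<longleftrightarrow> (\<forall>r\<in>R. \<forall>x\<in>L. r \<noteq> 0 \<and> r *s x \<in> I \<longrightarrow> x \<in> I)"

definition hermitian_form :: "(complex ^ 'n \<Rightarrow> complex ^ 'n \<Rightarrow> complex) \<Rightarrow> bool" where
  "hermitian_form h \<longleftrightarrow>
     (\<forall>x y z. h (x + y) z = h x z + h y z) \<and>
     (\<forall>c x y. h (c *s x) y = c * h x y) \<and>
     (\<forall>x y. h y x = cnj (h x y))"

text \<open>The condition on \<open>B\<close> says that \<open>L\<close> is a free \<open>\<int>\<close>-module with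
  \<open>L \<otimes> \<real> = complex ^ 'n\<close>. As \<open>F \<otimes> \<real> = \<complex>\<close>, for a finitely generated torsion-free module over the
  ring of integers this is the same as \<open>L \<otimes> \<complex> = complex ^ 'n\<close>. The form \<open>h\<close> is the
  sesquilinear extension of the form on \<open>L\<close>.\<close>

definition hermitian_lattice ::
  "int \<Rightarrow> (complex ^ 'n \<Rightarrow> complex ^ 'n \<Rightarrow> complex) \<Rightarrow> (complex ^ 'n) set \<Rightarrow> bool" where
  "hermitian_lattice d h L \<longleftrightarrow>
     submodule_over (quad_integers d) L \<and>
     (\<exists>B. independent B \<and> span B = UNIV \<and> L = submodule_over \<int> hull B) \<and>
     hermitian_form h \<and>
     (\<forall>x\<in>L. \<forall>y\<in>L. \<exists>a\<in>quad_integers d. h x y = kappa d * a) \<and>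
     (\<forall>x\<in>L. (\<forall>y\<in>L. h x y = 0) \<longrightarrow> x = 0)"

definition has_signature ::
  "(complex ^ 'n \<Rightarrow> complex ^ 'n \<Rightarrow> complex) \<Rightarrow> nat \<Rightarrow> nat \<Rightarrow> bool" where
  "has_signature h p q \<longleftrightarrow>
     (\<exists>B. vec.independent B \<and> vec.span B = UNIV \<and>
        (\<forall>x\<in>B. \<forall>y\<in>B. x \<noteq> y \<longrightarrow> h x y = 0) \<and>
        (\<forall>x\<in>B. h x x \<noteq> 0) \<and>
        card {x \<in> B. Re (h x x) > 0} = p \<and> card {x \<in> B. Re (h x x) < 0} = q)"

text \<open>The trace of \<open>F\<close> over \<open>\<rat>\<close> is \<open>z + cnj z\<close>, that is \<open>2 * Re z\<close>. The quadratic lattice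
  associated with \<open>(L, h)\<close> is the same set \<open>L\<close> with this form, here extended \<open>\<real>\<close>-bilinearly.\<close>

definition trace_form ::
  "(complex ^ 'n \<Rightarrow> complex ^ 'n \<Rightarrow> complex) \<Rightarrow> complex ^ 'n \<Rightarrow> complex ^ 'n \<Rightarrow> real" where
  "trace_form h x y = 2 * Re (h x y)"


section \<open>Cusps\<close>

text \<open>Ranks of sublattices of \<open>L\<close> are dimensions of spans: by the choice of the ambient space,
  \<open>I \<otimes> \<complex>\<close> (over the ring of integers) and \<open>J \<otimes> \<real>\<close> (over \<open>\<int>\<close>) embed into it, as the complex
  span of \<open>I\<close> and the real span of \<open>J\<close>.\<close>

definition unitary_cusp ::
  "int \<Rightarrow> (complex ^ 'n \<Rightarrow> complex ^ 'n \<Rightarrow> complex) \<Rightarrow> (complex ^ 'n) set \<Rightarrow> (complex ^ 'n) set \<Rightarrow> bool"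
  where
  "unitary_cusp d h L I \<longleftrightarrow>
     I \<subseteq> L \<and> submodule_over (quad_integers d) I \<and> vec.dim I = 1 \<and>
     primitive_in (quad_integers d) L I \<and> (\<forall>x\<in>I. \<forall>y\<in>I. h x y = 0)"

definition orthogonal_cusp ::
  "(complex ^ 'n \<Rightarrow> complex ^ 'n \<Rightarrow> real) \<Rightarrow> (complex ^ 'n) set \<Rightarrow> (complex ^ 'n) set \<Rightarrow> bool"
  where
  "orthogonal_cusp b L J \<longleftrightarrow>
     J \<subseteq> L \<and> submodule_over \<int> J \<and> dim J = 2 \<and>
     primitive_in \<int> L J \<and> (\<forall>x\<in>J. \<forall>y\<in>J. b x y = 0)"


section \<open>The type IV domain\<close>

text \<open>The complexification of a real vector space \<open>'v\<close> is \<open>'v \<times> 'v\<close>, where \<open>(x, y)\<close> stands for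
  \<open>x \<otimes> 1 + y \<otimes> \<i>\<close>. For \<open>'v = complex ^ 'n\<close> this second complex structure is unrelated to the one
  which \<open>complex ^ 'n\<close> already carries.\<close>

definition cx_scale :: "complex \<Rightarrow> 'v \<times> 'v \<Rightarrow> 'v::real_vector \<times> 'v" where
  "cx_scale c v =
     (Re c *\<^sub>R fst v - Im c *\<^sub>R snd v, Re c *\<^sub>R snd v + Im c *\<^sub>R fst v)"

definition cx_conj :: "'v \<times> 'v \<Rightarrow> 'v::real_vector \<times> 'v" where
  "cx_conj v = (fst v, - snd v)"

definition cx_form :: "('v \<Rightarrow> 'v \<Rightarrow> real) \<Rightarrow> 'v \<times> 'v \<Rightarrow> 'v \<times> 'v \<Rightarrow> complex" where
  "cx_form b v w =
     Complex (b (fst v) (fst w) - b (snd v) (snd w)) (b (fst v) (snd w) + b (snd v) (fst w))"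

definition proj_point :: "'v \<times> 'v \<Rightarrow> ('v::real_vector \<times> 'v) set" where
  "proj_point v = {cx_scale c v | c. c \<noteq> 0}"

definition proj_topology :: "('v::real_normed_vector \<times> 'v) set topology" where
  "proj_topology =
     topology (\<lambda>U. U \<subseteq> proj_point ` (- {0}) \<and> open {v. v \<noteq> 0 \<and> proj_point v \<in> U})"

lemma openin_proj_topology:
  fixes U :: "('v::real_normed_vector \<times> 'v) set set"
  shows "openin proj_topology U \<longleftrightarrow>
     U \<subseteq> proj_point ` (- {0}) \<and> open {v. v \<noteq> 0 \<and> proj_point v \<in> U}"
proof -
  have "istopology (\<lambda>U :: ('v \<times> 'v) set set.
      U \<subseteq> proj_point ` (- {0}) \<and> open {v. v \<noteq> 0 \<and> proj_point v \<in> U})"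
    unfolding istopology_def
  proof (intro conjI allI impI)
    fix S T :: "('v \<times> 'v) set set"
    assume S: "S \<subseteq> proj_point ` (- {0}) \<and> open {v. v \<noteq> 0 \<and> proj_point v \<in> S}"
      and T: "T \<subseteq> proj_point ` (- {0}) \<and> open {v. v \<noteq> 0 \<and> proj_point v \<in> T}"
    show "S \<inter> T \<subseteq> proj_point ` (- {0})" using S by blast
    have "{v. v \<noteq> 0 \<and> proj_point v \<in> S \<inter> T} =
        {v. v \<noteq> 0 \<and> proj_point v \<in> S} \<inter> {v. v \<noteq> 0 \<and> proj_point v \<in> T}" by blast
    then show "open {v. v \<noteq> 0 \<and> proj_point v \<in> S \<inter> T}" using S T by (simp add: open_Int)
  next
    fix K :: "('v \<times> 'v) set set set"
    assume K: "\<forall>U\<in>K. U \<subseteq> proj_point ` (- {0}) \<and> open {v. v \<noteq> 0 \<and> proj_point v \<in> U}"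
    show "\<Union>K \<subseteq> proj_point ` (- {0})" using K by blast
    have "{v. v \<noteq> 0 \<and> proj_point v \<in> \<Union>K} = (\<Union>U\<in>K. {v. v \<noteq> 0 \<and> proj_point v \<in> U})" by blast
    then show "open {v. v \<noteq> 0 \<and> proj_point v \<in> \<Union>K}" using K by (simp add: open_UN)
  qed
  then show ?thesis unfolding proj_topology_def by (simp add: topology_inverse')
qed

definition quadric_domain :: "('v \<Rightarrow> 'v \<Rightarrow> real) \<Rightarrow> ('v::real_normed_vector \<times> 'v) set set" where
  "quadric_domain b =
     {proj_point v | v. v \<noteq> 0 \<and> cx_form b v v = 0 \<and> Re (cx_form b v (cx_conj v)) > 0}"

text \<open>The candidates for the domain of the quadratic lattice; the notions below take a chosen
  component \<open>D\<close> as a parameter.\<close>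

definition domain_components :: "('v \<Rightarrow> 'v \<Rightarrow> real) \<Rightarrow> ('v::real_normed_vector \<times> 'v) set set set" where
  "domain_components b = connected_components_of (subtopology proj_topology (quadric_domain b))"


section \<open>Unitary and orthogonal groups\<close>

text \<open>Automorphisms of \<open>L\<close> and of \<open>L \<otimes> F\<close> (respectively \<open>L \<otimes> \<rat>\<close>) are represented by their unique
  \<open>\<complex>\<close>-linear (respectively \<open>\<real>\<close>-linear) extensions to the ambient space: the integral points are
  obtained with \<open>M = L\<close>, the rational points with \<open>M = L \<otimes> F\<close> or \<open>M = L \<otimes> \<rat>\<close>.\<close>

definition unitary_group ::
  "(complex ^ 'n \<Rightarrow> complex ^ 'n \<Rightarrow> complex) \<Rightarrow> (complex ^ 'n) set \<Rightarrow> (complex ^ 'n \<Rightarrow> complex ^ 'n) set"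
  where
  "unitary_group h M =
     {g. Vector_Spaces.linear (*s) (*s) g \<and> (\<forall>x y. h (g x) (g y) = h x y) \<and> g ` M = M}"

definition orthogonal_group ::
  "('v \<Rightarrow> 'v \<Rightarrow> real) \<Rightarrow> 'v set \<Rightarrow> ('v::real_vector \<Rightarrow> 'v) set" where
  "orthogonal_group b M = {g. linear g \<and> (\<forall>x y. b (g x) (g y) = b x y) \<and> g ` M = M}"

definition orthogonal_plus ::
  "('v \<Rightarrow> 'v \<Rightarrow> real) \<Rightarrow> ('v \<times> 'v) set set \<Rightarrow> 'v set \<Rightarrow> ('v::real_vector \<Rightarrow> 'v) set" where
  "orthogonal_plus b D M =
     {g \<in> orthogonal_group b M. (\<lambda>l. map_prod g g ` l) ` D = D}"

definition comp_group :: "('v \<Rightarrow> 'v) set \<Rightarrow> ('v \<Rightarrow> 'v) monoid" where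
  "comp_group G = \<lparr>carrier = G, mult = (\<circ>), one = id\<rparr>"

definition finite_index_subgroup :: "('v \<Rightarrow> 'v) set \<Rightarrow> ('v \<Rightarrow> 'v) set \<Rightarrow> bool" where
  "finite_index_subgroup H G \<longleftrightarrow>
     subgroup H (comp_group G) \<and> finite (rcosets\<^bsub>comp_group G\<^esub> H)"

text \<open>The embedding of the unitary into the orthogonal group forgets \<open>\<complex>\<close>-linearity, so the preimage
  of \<open>\<Gamma>\<close> is an intersection.\<close>

definition unitary_restriction ::
  "(complex ^ 'n \<Rightarrow> complex ^ 'n \<Rightarrow> complex) \<Rightarrow> (complex ^ 'n) set \<Rightarrow>
   (complex ^ 'n \<Rightarrow> complex ^ 'n) set \<Rightarrow> (complex ^ 'n \<Rightarrow> complex ^ 'n) set" where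
  "unitary_restriction h L \<Gamma> = {g \<in> unitary_group h L. g \<in> \<Gamma>}"


section \<open>The unipotent radical\<close>

definition unipotent :: "('v::real_vector \<Rightarrow> 'v) \<Rightarrow> bool" where
  "unipotent g \<longleftrightarrow> (\<exists>k. \<forall>x. ((\<lambda>y. g y - y) ^^ k) x = 0)"

text \<open>Polynomials with rational coefficients in the matrix entries of an endomorphism of the rational
  vector space \<open>V\<close> (which is a rational form of \<open>'v\<close>), and the resulting Zariski topology.\<close>

inductive_set matrix_polynomials :: "'v::real_vector set \<Rightarrow> (('v \<Rightarrow> 'v) \<Rightarrow> real) set"
  for V :: "'v set" where
  entry: "x \<in> V \<Longrightarrow> linear \<phi> \<Longrightarrow> \<phi> ` V \<subseteq> \<rat> \<Longrightarrow> (\<lambda>g. \<phi> (g x)) \<in> matrix_polynomials V"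
| const: "c \<in> \<rat> \<Longrightarrow> (\<lambda>g. c) \<in> matrix_polynomials V"
| add: "p \<in> matrix_polynomials V \<Longrightarrow> q \<in> matrix_polynomials V \<Longrightarrow>
    (\<lambda>g. p g + q g) \<in> matrix_polynomials V"
| mult: "p \<in> matrix_polynomials V \<Longrightarrow> q \<in> matrix_polynomials V \<Longrightarrow>
    (\<lambda>g. p g * q g) \<in> matrix_polynomials V"

definition zariski_topology :: "'v::real_vector set \<Rightarrow> ('v \<Rightarrow> 'v) topology" where
  "zariski_topology V = topology_generated_by {{g. p g \<noteq> 0} | p. p \<in> matrix_polynomials V}"

text \<open>The largest connected closed normal unipotent subgroup of a group \<open>G\<close> of automorphisms of \<open>V\<close>.
  We work with rational points throughout; this loses nothing here, because the Zariski
  closure of the stabilizers in question contains the identity component of the algebraic stabilizer.\<close>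

definition unipotent_radical :: "'v::real_vector set \<Rightarrow> ('v \<Rightarrow> 'v) set \<Rightarrow> ('v \<Rightarrow> 'v) set" where
  "unipotent_radical V G =
     \<Union>{N. N \<lhd> comp_group G \<and>
         closedin (subtopology (zariski_topology V) G) N \<and>
         connectedin (zariski_topology V) N \<and>
         (\<forall>g\<in>N. unipotent g)}"

definition group_center :: "('v \<Rightarrow> 'v) set \<Rightarrow> ('v \<Rightarrow> 'v) set" where
  "group_center N = {z \<in> N. \<forall>g\<in>N. z \<circ> g = g \<circ> z}"


section \<open>Types of cusps\<close>

definition Z_unitary ::
  "int \<Rightarrow> (complex ^ 'n \<Rightarrow> complex ^ 'n \<Rightarrow> complex) \<Rightarrow> (complex ^ 'n) set \<Rightarrow> (complex ^ 'n) set \<Rightarrow>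
   (complex ^ 'n \<Rightarrow> complex ^ 'n) set" where
  "Z_unitary d h L I =
    (let V = submodule_over (quad_field d) hull L; I_F = submodule_over (quad_field d) hull I in
     {T \<in> unitary_group h V.
        T ` I_F = I_F \<and> (\<forall>x\<in>V. (\<forall>y\<in>I. h x y = 0) \<longrightarrow> T x = x)})"

definition Z_orthogonal ::
  "(complex ^ 'n \<Rightarrow> complex ^ 'n \<Rightarrow> real) \<Rightarrow> ((complex ^ 'n) \<times> (complex ^ 'n)) set set \<Rightarrow>
   (complex ^ 'n) set \<Rightarrow> (complex ^ 'n) set \<Rightarrow> (complex ^ 'n \<Rightarrow> complex ^ 'n) set" where
  "Z_orthogonal b D L J =
    (let V = submodule_over \<rat> hull L; J_Q = submodule_over \<rat> hull J in
     group_center (unipotent_radical V {g \<in> orthogonal_plus b D V. g ` J_Q = J_Q}))"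

definition orthogonal_irregular ::
  "(complex ^ 'n \<Rightarrow> complex ^ 'n \<Rightarrow> real) \<Rightarrow> ((complex ^ 'n) \<times> (complex ^ 'n)) set set \<Rightarrow>
   (complex ^ 'n) set \<Rightarrow> (complex ^ 'n \<Rightarrow> complex ^ 'n) set \<Rightarrow> (complex ^ 'n) set \<Rightarrow> bool" where
  "orthogonal_irregular b D L \<Gamma> J \<longleftrightarrow>
     (\<lambda>x. - x) \<notin> \<Gamma> \<and> (\<exists>T \<in> Z_orthogonal b D L J. (\<lambda>x. - T x) \<in> \<Gamma>)"

definition orthogonal_regular ::
  "(complex ^ 'n \<Rightarrow> complex ^ 'n \<Rightarrow> real) \<Rightarrow> ((complex ^ 'n) \<times> (complex ^ 'n)) set set \<Rightarrow>
   (complex ^ 'n) set \<Rightarrow> (complex ^ 'n \<Rightarrow> complex ^ 'n) set \<Rightarrow> (complex ^ 'n) set \<Rightarrow> bool" where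
  "orthogonal_regular b D L \<Gamma> J \<longleftrightarrow> \<not> orthogonal_irregular b D L \<Gamma> J"

text \<open>The field \<open>F\<close> is recorded by the square-free integer \<open>d\<close>; \<open>w\<close> is a primitive cube root of
  unity and \<open>m\<close> is the index.\<close>

definition has_scalar :: "(complex ^ 'n \<Rightarrow> complex ^ 'n) set \<Rightarrow> complex \<Rightarrow> bool" where
  "has_scalar \<Gamma> c \<longleftrightarrow> (\<lambda>x. c *s x) \<in> \<Gamma>"

definition has_scaled ::
  "(complex ^ 'n \<Rightarrow> complex ^ 'n) set \<Rightarrow> (complex ^ 'n \<Rightarrow> complex ^ 'n) set \<Rightarrow> complex \<Rightarrow> bool" where
  "has_scaled \<Gamma> Z c \<longleftrightarrow> (\<exists>T\<in>Z. (\<lambda>x. c *s T x) \<in> \<Gamma>)"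

definition unitary_semi_irregular ::
  "int \<Rightarrow> complex \<Rightarrow> (complex ^ 'n \<Rightarrow> complex ^ 'n \<Rightarrow> complex) \<Rightarrow> (complex ^ 'n) set \<Rightarrow>
   (complex ^ 'n \<Rightarrow> complex ^ 'n) set \<Rightarrow> nat \<Rightarrow> (complex ^ 'n) set \<Rightarrow> bool" where
  "unitary_semi_irregular d w h L \<Gamma> m I \<longleftrightarrow>
    (let Z = Z_unitary d h L I in
     (d = -1 \<and> m = 2 \<and> has_scalar \<Gamma> (-1) \<and> \<not> has_scalar \<Gamma> \<i> \<and> has_scaled \<Gamma> Z \<i>) \<or>
     (d = -3 \<and> m = 2 \<and> has_scalar \<Gamma> w \<and> \<not> has_scalar \<Gamma> (-1) \<and> has_scaled \<Gamma> Z (-1)) \<or>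
     (d = -3 \<and> m = 3 \<and> has_scalar \<Gamma> (-1) \<and> \<not> has_scalar \<Gamma> w \<and> has_scaled \<Gamma> Z w))"

definition unitary_irregular_4 ::
  "int \<Rightarrow> (complex ^ 'n \<Rightarrow> complex ^ 'n \<Rightarrow> complex) \<Rightarrow> (complex ^ 'n) set \<Rightarrow>
   (complex ^ 'n \<Rightarrow> complex ^ 'n) set \<Rightarrow> (complex ^ 'n) set \<Rightarrow> bool" where
  "unitary_irregular_4 d h L \<Gamma> I \<longleftrightarrow>
     d = -1 \<and> \<not> has_scalar \<Gamma> (-1) \<and> \<not> has_scalar \<Gamma> \<i> \<and> has_scaled \<Gamma> (Z_unitary d h L I) (- \<i>)"

definition unitary_irregular_6 ::
  "int \<Rightarrow> complex \<Rightarrow> (complex ^ 'n \<Rightarrow> complex ^ 'n \<Rightarrow> complex) \<Rightarrow> (complex ^ 'n) set \<Rightarrow>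
   (complex ^ 'n \<Rightarrow> complex ^ 'n) set \<Rightarrow> (complex ^ 'n) set \<Rightarrow> bool" where
  "unitary_irregular_6 d w h L \<Gamma> I \<longleftrightarrow>
     d = -3 \<and> \<not> has_scalar \<Gamma> (-1) \<and> \<not> has_scalar \<Gamma> w \<and> has_scaled \<Gamma> (Z_unitary d h L I) (- w)"

definition unitary_irregular ::
  "int \<Rightarrow> complex \<Rightarrow> (complex ^ 'n \<Rightarrow> complex ^ 'n \<Rightarrow> complex) \<Rightarrow> (complex ^ 'n) set \<Rightarrow>
   (complex ^ 'n \<Rightarrow> complex ^ 'n) set \<Rightarrow> nat \<Rightarrow> (complex ^ 'n) set \<Rightarrow> bool" where
  "unitary_irregular d w h L \<Gamma> m I \<longleftrightarrow>
    (let Z = Z_unitary d h L I in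
     (d = -1 \<and> m = 4 \<and> unitary_irregular_4 d h L \<Gamma> I) \<or>
     (d = -1 \<and> m = 2 \<and> \<not> has_scalar \<Gamma> (-1) \<and> has_scaled \<Gamma> Z (-1) \<and>
        \<not> unitary_irregular_4 d h L \<Gamma> I) \<or>
     (d = -3 \<and> m = 6 \<and> unitary_irregular_6 d w h L \<Gamma> I) \<or>
     (d = -3 \<and> m = 3 \<and> \<not> has_scalar \<Gamma> (-1) \<and> \<not> has_scalar \<Gamma> w \<and> has_scaled \<Gamma> Z w \<and>
        \<not> unitary_irregular_6 d w h L \<Gamma> I) \<or>
     (d = -3 \<and> m = 2 \<and> \<not> has_scalar \<Gamma> (-1) \<and> has_scaled \<Gamma> Z (-1) \<and>
        \<not> unitary_semi_irregular d w h L \<Gamma> 2 I \<and> \<not> unitary_irregular_6 d w h L \<Gamma> I) \<or>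
     (d \<noteq> -1 \<and> d \<noteq> -3 \<and> m = 2 \<and> \<not> has_scalar \<Gamma> (-1) \<and> has_scaled \<Gamma> Z (-1)))"

definition unitary_regular ::
  "int \<Rightarrow> complex \<Rightarrow> (complex ^ 'n \<Rightarrow> complex ^ 'n \<Rightarrow> complex) \<Rightarrow> (complex ^ 'n) set \<Rightarrow>
   (complex ^ 'n \<Rightarrow> complex ^ 'n) set \<Rightarrow> (complex ^ 'n) set \<Rightarrow> bool" where
  "unitary_regular d w h L \<Gamma> I \<longleftrightarrow>
     (\<forall>m. \<not> unitary_irregular d w h L \<Gamma> m I \<and> \<not> unitary_semi_irregular d w h L \<Gamma> m I)"

end

theory Submission
  imports Defs
begin

text \<open>The point is that the unitary and the orthogonal notion of center are the same set of
  transformations. Let \<open>e\<close> span the isotropic line. A normal unipotent subgroup of the stabilizer of the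
  line in the orthogonal group acts trivially on the orthogonal complement of \<open>e\<close> modulo the line,
  because the form is definite there, and trivially on the line, because the stabilizer contains
  multiplication by nonreal field elements of norm 1. Hence the unipotent radical consists of the
  elements acting trivially on the graded pieces of the filtration. An element of its center commutes
  with all Eichler transvections, so it fixes the complement of \<open>e\<close> pointwise, and such an isometry is
  \<open>x \<mapsto> x + \<i> t h(x, e) e\<close> with \<open>t\<close> real, which is complex linear. With a common center, the types are
  compared by multiplying the elements \<open>c T\<close> of the group.\<close>

section \<open>Groups of transformations\<close>

text \<open>Two kinds of conditions pull apart. Membership in \<open>orthogonal_plus\<close>
  includes a real topological condition, since the component \<open>D\<close> has to be preserved,
  while \<open>V\<close> and \<open>J\<close> are rational. An isometry that has to be placed in the
  stabilizer is therefore put on a real one-parameter group of isometries, whose orbits are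
  connected and so stay in their component; the rational spaces are examined only at the parameter
  of interest. The unipotent radical is a union of subgroups, so its computation has two halves: the
  candidate has to be normal, closed, connected and unipotent itself, and it has to contain every
  other such subgroup. Connectedness comes from rational powers: if \<open>(g - 1)^3 = 0\<close>,
  then \<open>g^t\<close> is quadratic in \<open>t\<close> and joins \<open>g\<close> to the
  identity. Orthogonal isometries are only real linear. Complex linearity of a central element has
  to be derived; it comes from the fact that an alternating form on a real plane depends on a single
  real number.\<close>

lemma comp_group_simps [simp]:
  "carrier (comp_group G) = G" "mult (comp_group G) = (\<circ>)" "one (comp_group G) = id"
  by (simp_all add: comp_group_def)

lemma group_comp_group:
  assumes "\<And>f g. f \<in> G \<Longrightarrow> g \<in> G \<Longrightarrow> f \<circ> g \<in> G" "id \<in> G"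
    "\<And>g. g \<in> G \<Longrightarrow> \<exists>f\<in>G. f \<circ> g = id"
  shows "group (comp_group G)"
  using assms by (intro groupI) (auto simp: comp_assoc)

section \<open>Connectedness\<close>

lemma proj_point_map_prod:
  fixes g :: "'v::real_vector \<Rightarrow> 'v"
  assumes "linear g"
  shows "map_prod g g ` proj_point v = proj_point (map_prod g g v)"
proof -
  have "map_prod g g (cx_scale c w) = cx_scale c (map_prod g g w)" for c w
    using assms by (cases w) (simp add: cx_scale_def linear_add linear_diff linear_cmul)
  then show ?thesis
    unfolding proj_point_def setcompr_eq_image image_image by simp
qed

lemma one_parameter_quadric_domain:
  fixes b :: "'v::real_normed_vector \<Rightarrow> 'v \<Rightarrow> real" and f :: "real \<Rightarrow> 'v \<Rightarrow> 'v"
  assumes lin: "\<And>t. linear (f t)"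
    and isom: "\<And>t x y. b (f t x) (f t y) = b x y"
    and zero: "\<And>x. f 0 x = x" and add: "\<And>s t x. f (s + t) x = f s (f t x)"
    and v: "v \<noteq> 0" "proj_point v \<in> quadric_domain b"
  shows "map_prod (f t) (f t) v \<noteq> 0" "proj_point (map_prod (f t) (f t) v) \<in> quadric_domain b"
proof -
  have nz: "map_prod (f t) (f t) w \<noteq> 0" if "w \<noteq> 0" for w
  proof
    assume "map_prod (f t) (f t) w = 0"
    then have "f t (fst w) = 0" "f t (snd w) = 0" by (cases w; simp add: zero_prod_def)+
    then have "f (-t) (f t (fst w)) = 0" "f (-t) (f t (snd w)) = 0"
      using linear_0[OF lin] by simp_all
    then have "fst w = 0" "snd w = 0" using add[of "-t" t] zero by simp_all
    with \<open>w \<noteq> 0\<close> show False by (simp add: prod_eq_iff)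
  qed
  show "map_prod (f t) (f t) v \<noteq> 0" using nz v(1) by blast
  obtain w where w: "proj_point v = proj_point w" "w \<noteq> 0" "cx_form b w w = 0"
      "Re (cx_form b w (cx_conj w)) > 0"
    using v unfolding quadric_domain_def by blast
  let ?w = "map_prod (f t) (f t) w"
  have "cx_form b ?w ?w = cx_form b w w"
    by (cases w) (simp add: cx_form_def isom)
  moreover have "cx_conj ?w = map_prod (f t) (f t) (cx_conj w)"
    using linear_neg[OF lin] by (cases w) (simp add: cx_conj_def)
  then have "cx_form b ?w (cx_conj ?w) = cx_form b w (cx_conj w)"
    by (cases w) (simp add: cx_form_def isom cx_conj_def)
  moreover have "proj_point ?w = proj_point (map_prod (f t) (f t) v)"
    using proj_point_map_prod[OF lin] w(1) by metis
  ultimately show "proj_point (map_prod (f t) (f t) v) \<in> quadric_domain b"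
    using w(3,4) nz[OF w(2)] unfolding quadric_domain_def
    by (intro CollectI exI[of _ ?w]) simp
qed

lemma topspace_proj_topology:
  "topspace (proj_topology :: ('v::real_normed_vector \<times> 'v) set topology) = proj_point ` (- {0})"
proof -
  have "openin proj_topology (proj_point ` (- {0}) :: ('v \<times> 'v) set set)"
  proof -
    have "{v :: 'v \<times> 'v. v \<noteq> 0 \<and> proj_point v \<in> proj_point ` (- {0})} = - {0}" by auto
    then show ?thesis unfolding openin_proj_topology by (simp add: open_Compl)
  qed
  then show ?thesis
    using openin_subset openin_proj_topology[THEN iffD1, OF openin_topspace] by (intro equalityI) auto
qed

text \<open>Open sets of the projective space are tested on their cones of nonzero vectors, so
  preimages along the curve are preimages of open cones under \<open>p\<close>.\<close>

lemma continuous_map_proj_point: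
  fixes p :: "real \<Rightarrow> 'v::real_normed_vector \<times> 'v"
  assumes "continuous_on UNIV p" "\<And>t. p t \<noteq> 0"
  shows "continuous_map euclideanreal proj_topology (\<lambda>t. proj_point (p t))"
  unfolding continuous_map topspace_proj_topology
proof (intro conjI allI impI)
  show "(\<lambda>t. proj_point (p t)) ` topspace euclideanreal \<subseteq> proj_point ` (- {0})"
    using assms(2) by auto
next
  fix U :: "('v \<times> 'v) set set" assume "openin proj_topology U"
  then have "open {v. v \<noteq> 0 \<and> proj_point v \<in> U}" by (simp add: openin_proj_topology)
  then have "open (p -` {v. v \<noteq> 0 \<and> proj_point v \<in> U})"
    using assms(1) continuous_on_open_vimage open_UNIV by fastforce
  then show "openin euclideanreal {x \<in> topspace euclideanreal. proj_point (p x) \<in> U}"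
    using assms(2) by (simp add: vimage_def)
qed

text \<open>The orbit of a point under a one-parameter group is connected.\<close>

lemma one_parameter_group_preserves_component:
  fixes b :: "'v::real_normed_vector \<Rightarrow> 'v \<Rightarrow> real" and f :: "real \<Rightarrow> 'v \<Rightarrow> 'v"
  assumes D: "D \<in> domain_components b"
    and lin: "\<And>t. linear (f t)"
    and isom: "\<And>t x y. b (f t x) (f t y) = b x y"
    and zero: "\<And>x. f 0 x = x" and add: "\<And>s t x. f (s + t) x = f s (f t x)"
    and cont: "\<And>x. continuous_on UNIV (\<lambda>t. f t x)"
  shows "(\<lambda>l. map_prod (f t) (f t) ` l) ` D = D"
proof -
  let ?X = "subtopology proj_topology (quadric_domain b)"
  have *: "map_prod (f t) (f t) ` l \<in> D" if l: "l \<in> D" for l t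
  proof -
    have "l \<in> quadric_domain b"
      using D l connected_components_of_subset unfolding domain_components_def by fastforce
    then obtain v where v: "v \<noteq> 0" "l = proj_point v" "proj_point v \<in> quadric_domain b"
      unfolding quadric_domain_def by blast
    define p where "p = (\<lambda>t. map_prod (f t) (f t) v)"
    have "p = (\<lambda>t. (f t (fst v), f t (snd v)))" by (cases v) (simp add: p_def)
    then have "continuous_on UNIV p" using cont by (simp add: continuous_on_Pair)
    then have "continuous_map euclideanreal proj_topology (\<lambda>t. proj_point (p t))"
      using one_parameter_quadric_domain(1)[OF lin isom zero add v(1,3)]
      by (intro continuous_map_proj_point) (auto simp: p_def)
    then have "continuous_map euclideanreal ?X (\<lambda>t. proj_point (p t))"
      using one_parameter_quadric_domain(2)[OF lin isom zero add v(1,3)]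
      by (auto simp: continuous_map_in_subtopology p_def)
    then have "connectedin ?X ((\<lambda>t. proj_point (p t)) ` UNIV)"
      by (rule connectedin_continuous_map_image) (simp add: connectedin_absolute)
    moreover have "p 0 = v" using zero by (cases v) (simp add: p_def)
    then have "l \<in> (\<lambda>t. proj_point (p t)) ` UNIV" using v(2) by (metis rangeI)
    \<comment> \<open>\<open>l\<close> lies in both sets, and a component absorbs every connected
      set that it meets.\<close>
    ultimately have "(\<lambda>t. proj_point (p t)) ` UNIV \<subseteq> D"
      using connected_components_of_maximal[of D ?X] D l
      unfolding domain_components_def disjnt_def by blast
    then show ?thesis using v(2) proj_point_map_prod[OF lin] by (auto simp: p_def)
  qed
  have "l \<in> (\<lambda>l. map_prod (f t) (f t) ` l) ` D" if "l \<in> D" for l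
  proof -
    have "map_prod (f t) (f t) ` map_prod (f (-t)) (f (-t)) ` l = l"
      using add[of t "-t"] zero by (simp add: image_image map_prod_def case_prod_beta)
    then show ?thesis using *[OF that, of "-t"] by (metis image_eqI)
  qed
  with * show ?thesis by blast
qed

text \<open>The isometry conditions concern all real parameters, because the orbit has to be
  connected. Stability of \<open>V\<close> is asked only at \<open>t\<close> and \<open>-t\<close>,
  since the rest of the flow need not respect a rational space.\<close>

lemma orthogonal_plus_one_parameter:
  fixes b :: "'v::real_normed_vector \<Rightarrow> 'v \<Rightarrow> real" and f :: "real \<Rightarrow> 'v \<Rightarrow> 'v"
  assumes D: "D \<in> domain_components b"
    and lin: "\<And>t. linear (f t)"
    and isom: "\<And>t x y. b (f t x) (f t y) = b x y"
    and zero: "\<And>x. f 0 x = x" and add: "\<And>s t x. f (s + t) x = f s (f t x)"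
    and cont: "\<And>x. continuous_on UNIV (\<lambda>t. f t x)"
    and V: "f t ` V \<subseteq> V" "f (-t) ` V \<subseteq> V"
  shows "f t \<in> orthogonal_plus b D V"
proof -
  have "x \<in> f t ` V" if "x \<in> V" for x
    using that V(2) add[of t "-t" x] zero by (intro image_eqI[of _ _ "f (-t) x"]) auto
  then have "f t ` V = V" using V(1) by blast
  then show ?thesis
    using lin isom one_parameter_group_preserves_component[OF D lin isom zero add cont]
    by (simp add: orthogonal_plus_def orthogonal_group_def)
qed

text \<open>The parameter domain carries the cofinite topology.\<close>

lemma connectedin_zariski_topology_curve:
  fixes V :: "'v::real_vector set" and f :: "real \<Rightarrow> 'v \<Rightarrow> 'v"
  assumes f: "\<And>p. p \<in> matrix_polynomials V \<Longrightarrow> \<exists>P. \<forall>t. p (f t) = poly P t"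
  shows "connectedin (zariski_topology V) (f ` \<rat>)"
proof -
  \<comment> \<open>The parameters are rational because the curves to be treated are powers
    \<open>g^t\<close> of a unipotent map, which preserve \<open>V\<close> for rational
    \<open>t\<close>.\<close>
  define X where "X = topology (\<lambda>U :: real set. U \<subseteq> \<rat> \<and> (U = {} \<or> finite (\<rat> - U)))"
  have "istopology (\<lambda>U :: real set. U \<subseteq> \<rat> \<and> (U = {} \<or> finite (\<rat> - U)))"
    unfolding istopology_def
  proof (intro conjI allI impI)
    fix S T :: "real set"
    assume "S \<subseteq> \<rat> \<and> (S = {} \<or> finite (\<rat> - S))" "T \<subseteq> \<rat> \<and> (T = {} \<or> finite (\<rat> - T))"
    then show "S \<inter> T \<subseteq> \<rat>" "S \<inter> T = {} \<or> finite (\<rat> - S \<inter> T)" by (auto simp: Diff_Int)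
  next
    fix K :: "real set set"
    assume K: "\<forall>U\<in>K. U \<subseteq> \<rat> \<and> (U = {} \<or> finite (\<rat> - U))"
    show "\<Union>K \<subseteq> \<rat>" using K by blast
    show "\<Union>K = {} \<or> finite (\<rat> - \<Union>K)"
    proof (cases "\<exists>U\<in>K. U \<noteq> {}")
      case True
      then obtain U where U: "U \<in> K" "finite (\<rat> - U)" using K by blast
      have "\<rat> - \<Union>K \<subseteq> \<rat> - U" using U(1) by blast
      then show ?thesis using U(2) finite_subset by blast
    qed blast
  qed
  then have openX: "openin X U \<longleftrightarrow> U \<subseteq> \<rat> \<and> (U = {} \<or> finite (\<rat> - U))" for U
    unfolding X_def by (simp add: topology_inverse')
  have topX: "topspace X = \<rat>"
  proof
    show "topspace X \<subseteq> \<rat>" using openX[of "topspace X"] by simp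
    show "\<rat> \<subseteq> topspace X" using openX[of \<rat>] openin_subset by auto
  qed
  have "connected_space X"
    unfolding connected_space_def
  proof (intro notI, elim exE conjE)
    fix S T assume S: "openin X S" and T: "openin X T" and cov: "topspace X \<subseteq> S \<union> T"
      and dis: "S \<inter> T = {}" and "S \<noteq> {}" "T \<noteq> {}"
    then have "finite ((\<rat> - S) \<union> (\<rat> - T))" by (simp add: openX)
    moreover have "(\<rat> - S) \<union> (\<rat> - T) = (\<rat> :: real set)" using dis by blast
    moreover have "infinite (\<rat> :: real set)" 
      by (metis Nats_def Nats_subset_Rats finite_subset finite_imageD infinite_UNIV_nat inj_of_nat)
    ultimately show False by simp
  qed
  moreover have "continuous_map X (zariski_topology V) f"
    unfolding zariski_topology_def
  proof (rule continuous_on_generated_topo)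
    fix U :: "('v \<Rightarrow> 'v) set" assume "U \<in> {{g. p g \<noteq> 0} |p. p \<in> matrix_polynomials V}"
    then obtain p where p: "p \<in> matrix_polynomials V" "U = {g. p g \<noteq> 0}" by blast
    from f[OF p(1)] obtain P where P: "\<And>t. p (f t) = poly P t" by blast
    \<comment> \<open>A basic open set pulls back to the complement of the zeros of a polynomial in
      \<open>t\<close>: cofinite if the polynomial is nonzero, empty otherwise.\<close>
    show "openin X (f -` U \<inter> topspace X)"
    proof (cases "P = 0")
      case True
      then have "f -` U = {}" using p(2) P by auto
      then show ?thesis by simp
    next
      case False
      have "\<rat> - f -` U \<inter> \<rat> \<subseteq> {t. poly P t = 0}" using p(2) P by auto
      then have "finite (\<rat> - f -` U \<inter> \<rat>)" using False poly_roots_finite finite_subset by blast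
      then show ?thesis by (simp add: openX topX)
    qed
  next
    \<comment> \<open>A generated topology lives on the union of its generators; the constant 1
      shows that this union is everything.\<close>
    have "(\<lambda>g. 1) \<in> matrix_polynomials V" by (rule matrix_polynomials.const) simp
    then have "{g. (1 :: real) \<noteq> 0} \<in> {{g. p g \<noteq> 0} |p. p \<in> matrix_polynomials V}"
      by (intro CollectI exI[of _ "\<lambda>g. 1"] conjI refl)
    then have "{g. (1 :: real) \<noteq> 0} \<subseteq> \<Union>{{g. p g \<noteq> 0} |p. p \<in> matrix_polynomials V}"
      by (rule Union_upper)
    then show "f ` topspace X \<subseteq> \<Union>{{g. p g \<noteq> 0} |p. p \<in> matrix_polynomials V}"
      by (rule order_trans[rotated]) simp
  qed
  moreover have "connectedin X \<rat>"
    using \<open>connected_space X\<close> connectedin_topspace[of X] topX by simp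
  ultimately show ?thesis using connectedin_continuous_map_image by blast
qed

lemma closedin_zariski_topology_zero:
  assumes "p \<in> matrix_polynomials V"
  shows "closedin (zariski_topology V) {g. p g = 0}"
proof -
  have op: "openin (zariski_topology V) {g. q g \<noteq> 0}" if "q \<in> matrix_polynomials V" for q
    unfolding zariski_topology_def by (rule topology_generated_by_Basis) (use that in blast)
  have "(\<lambda>g. 1) \<in> matrix_polynomials V" by (rule matrix_polynomials.const) simp
  from op[OF this] have "topspace (zariski_topology V) = UNIV"
    using openin_subset by fastforce
  moreover have "UNIV - {g. p g = 0} = {g. p g \<noteq> 0}" by blast
  ultimately show ?thesis using op[OF assms] by (simp add: closedin_def)
qed

section \<open>The field and its action\<close>

lemma scaleR_eq_smult: "r *\<^sub>R (x :: complex ^ 'n) = of_real r *s x"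
  by (simp add: vec_eq_iff) (simp add: scaleR_conv_of_real)

lemma of_real_of_rat_complex: "complex_of_real (of_rat a) = of_rat a"
  by (cases a) (simp add: of_rat_rat)

lemma csqrt_of_neg_int:
  assumes "d < 0"
  shows "csqrt (of_int d) = \<i> * of_real (sqrt (- of_int d))"
  using assms by (subst csqrt_of_real_nonpos) auto

lemma cnj_csqrt_neg: "d < 0 \<Longrightarrow> cnj (csqrt (of_int d)) = - csqrt (of_int d)"
  by (simp add: csqrt_of_neg_int)

lemma Im_csqrt_neg: "d < 0 \<Longrightarrow> Im (csqrt (of_int d)) > 0"
  by (simp add: csqrt_of_neg_int)

lemma Rats_complex_iff: "z \<in> \<rat> \<longleftrightarrow> (\<exists>r\<in>\<rat>. z = complex_of_real r)"
  by (auto elim!: Rats_cases simp: Rats_def image_iff of_real_of_rat_complex)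

lemma quad_field_Rats: "z \<in> \<rat> \<Longrightarrow> z \<in> quad_field d"
proof (elim Rats_cases)
  fix r assume "z = of_rat r"
  then have "z = of_rat r + of_rat 0 * csqrt (of_int d)" by simp
  then show ?thesis unfolding quad_field_def by blast
qed

lemma csqrt_in_quad_field: "csqrt (of_int d) \<in> quad_field d"
  unfolding quad_field_def by (intro CollectI exI[of _ 0] exI[of _ 1]) simp

lemma quad_field_add: "x \<in> quad_field d \<Longrightarrow> y \<in> quad_field d \<Longrightarrow> x + y \<in> quad_field d"
proof -
  assume "x \<in> quad_field d" "y \<in> quad_field d"
  then obtain a b a' b' where "x = of_rat a + of_rat b * csqrt (of_int d)"
    "y = of_rat a' + of_rat b' * csqrt (of_int d)" unfolding quad_field_def by blast
  then have "x + y = of_rat (a + a') + of_rat (b + b') * csqrt (of_int d)"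
    by (simp add: of_rat_add algebra_simps)
  then show ?thesis unfolding quad_field_def by blast
qed

lemma quad_field_mult: "x \<in> quad_field d \<Longrightarrow> y \<in> quad_field d \<Longrightarrow> x * y \<in> quad_field d"
proof -
  assume "x \<in> quad_field d" "y \<in> quad_field d"
  then obtain a b a' b' where "x = of_rat a + of_rat b * csqrt (of_int d)"
    "y = of_rat a' + of_rat b' * csqrt (of_int d)" unfolding quad_field_def by blast
  moreover have "csqrt (of_int d) * csqrt (of_int d) = of_int d"
    by (metis power2_csqrt power2_eq_square)
  then have "of_rat b * csqrt (of_int d) * (of_rat b' * csqrt (of_int d)) = of_rat (b * b' * of_int d)"
    by (simp add: of_rat_mult algebra_simps)
  ultimately have "x * y = of_rat (a * a' + b * b' * of_int d)
      + of_rat (a * b' + b * a') * csqrt (of_int d)"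
    by (simp add: of_rat_add of_rat_mult algebra_simps)
  then show ?thesis unfolding quad_field_def by blast
qed

lemma quad_field_uminus: "x \<in> quad_field d \<Longrightarrow> - x \<in> quad_field d"
  using quad_field_mult[of "-1"] quad_field_Rats[of "-1"] by simp

lemma cnj_of_rat: "cnj (of_rat a) = of_rat a"
  by (metis complex_cnj_complex_of_real of_real_of_rat_complex)

lemma quad_field_cnj:
  assumes "d < 0" "x \<in> quad_field d"
  shows "cnj x \<in> quad_field d"
proof -
  obtain a b where "x = of_rat a + of_rat b * csqrt (of_int d)"
    using assms(2) unfolding quad_field_def by blast
  then have "cnj x = of_rat a + of_rat (- b) * csqrt (of_int d)"
    by (simp add: cnj_csqrt_neg[OF assms(1)] cnj_of_rat of_rat_minus)
  then show ?thesis unfolding quad_field_def by blast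
qed

lemma quad_field_trace:
  assumes "d < 0" "x \<in> quad_field d"
  shows "2 * Re x \<in> \<rat>"
proof -
  obtain a b where "x = of_rat a + of_rat b * csqrt (of_int d)"
    using assms(2) unfolding quad_field_def by blast
  then have "2 * Re x = of_rat (2 * a)"
    by (simp add: csqrt_of_neg_int[OF assms(1)] of_rat_mult flip: of_real_of_rat_complex)
  then show ?thesis by simp
qed

lemma quad_field_inverse:
  assumes "d < 0" "x \<in> quad_field d"
  shows "inverse x \<in> quad_field d"
proof -
  obtain a b where ab: "x = of_rat a + of_rat b * csqrt (of_int d)"
    using assms(2) unfolding quad_field_def by blast
  have "x * cnj x = (of_rat a)^2 - (of_rat b)^2 * (csqrt (of_int d))^2"
    by (simp add: ab cnj_of_rat cnj_csqrt_neg assms(1) algebra_simps power2_eq_square)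
  then have "x * cnj x = of_rat (a^2 - b^2 * of_int d)"
    by (simp add: of_rat_diff of_rat_mult of_rat_power)
  then have "inverse (x * cnj x) \<in> \<rat>" by (metis Rats_inverse Rats_of_rat)
  then have "cnj x * inverse (x * cnj x) \<in> quad_field d"
    using quad_field_mult quad_field_cnj[OF assms] quad_field_Rats by blast
  moreover have "cnj x * inverse (x * cnj x) = inverse x"
    by (cases "x = 0") (simp_all add: field_simps)
  ultimately show ?thesis by metis
qed

text \<open>The witness is \<open>w / cnj w\<close> for \<open>w = 1 + csqrt (of_int d)\<close>, a
  quotient of conjugates and hence of modulus 1.\<close>

lemma quad_field_nonreal_unit:
  assumes "d < 0"
  obtains z where "z \<in> quad_field d" "cmod z = 1" "Im z \<noteq> 0"
proof -
  define s where "s = csqrt (of_int d)"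
  have s: "Re s = 0" "Im s > 0" using assms by (simp_all add: s_def csqrt_of_neg_int)
  define z where "z = (1 + s) * inverse (1 - s)"
  have "z \<in> quad_field d" unfolding z_def
    using assms csqrt_in_quad_field[of d, folded s_def] quad_field_Rats[of 1 d]
    by (metis Rats_1 diff_conv_add_uminus quad_field_add quad_field_inverse quad_field_mult
        quad_field_uminus)
  moreover have "cnj (1 - s) = 1 + s" using s by (simp add: complex_eq_iff)
  then have "cmod (1 + s) = cmod (1 - s)" by (metis complex_mod_cnj)
  then have "cmod z = 1" using s by (auto simp: z_def norm_mult norm_inverse complex_eq_iff)
  moreover have "Im z = 2 * Im s / (1 + (Im s)^2)"
    using s by (simp add: z_def power2_eq_square)
  then have "Im z \<noteq> 0" using s by (simp add: add_nonneg_eq_0_iff)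
  ultimately show ?thesis using that by blast
qed

text \<open>Real coordinates with respect to the basis \<open>1, z\<close>. A general
  \<open>z\<close> is allowed because the rational line \<open>J\<close> is stable under a square
  root of \<open>d\<close>, but in general not under \<open>\<i>\<close>.\<close>

lemma complex_real_combination:
  assumes "Im z \<noteq> 0"
  shows "c = of_real (Re c - Im c / Im z * Re z) + of_real (Im c / Im z) * z"
  using assms by (simp add: complex_eq_iff)

lemma submodule_over_diff:
  assumes "submodule_over R M" "-1 \<in> R" "x \<in> M" "y \<in> M"
  shows "x - y \<in> M"
  using assms unfolding submodule_over_def
  by (metis diff_conv_add_uminus vector_sneg_minus1)

lemma nilpotent_kernel:
  fixes f :: "'v::real_vector \<Rightarrow> 'v"
  assumes "(f ^^ k) x = 0" "x \<noteq> 0"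
  shows "\<exists>j. (f ^^ j) x \<noteq> 0 \<and> f ((f ^^ j) x) = 0"
  using assms by (induction k) auto

section \<open>The stabilizer of an isotropic line\<close>

text \<open>\<open>V\<close> and \<open>J\<close> stand for the rational spaces of the lattice and
  of the cusp, inside the complex ambient space. \<open>definite\<close> is the trace left by
  signature \<open>(1, n)\<close>: on the complement of \<open>e\<close> the form is negative off
  the line of \<open>e\<close>.\<close>

locale isotropic_line =
  fixes d :: int and h :: "complex ^ 'n \<Rightarrow> complex ^ 'n \<Rightarrow> complex"
    and V J :: "(complex ^ 'n) set" and D :: "((complex ^ 'n) \<times> (complex ^ 'n)) set set"
    and e :: "complex ^ 'n"
  assumes d_neg: "d < 0"
    and herm: "hermitian_form h"
    and nondegenerate: "(\<And>y. h x y = 0) \<Longrightarrow> x = 0"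
    and definite: "h x e = 0 \<Longrightarrow> 0 \<le> Re (h x x) \<Longrightarrow> \<exists>c. x = c *s e"
    and isotropic: "h e e = 0"
    and e: "e \<in> J" "e \<noteq> 0"
    and J: "submodule_over (quad_field d) J" "J \<subseteq> V" "x \<in> J \<Longrightarrow> \<exists>c. x = c *s e"
    and V: "submodule_over (quad_field d) V" "span V = UNIV"
    and rational: "x \<in> V \<Longrightarrow> y \<in> V \<Longrightarrow> h x y \<in> quad_field d"
    and D: "D \<in> domain_components (trace_form h)"
begin

abbreviation "b \<equiv> trace_form h"

lemma h_add_left: "h (x + y) z = h x z + h y z"
  and h_smult_left: "h (c *s x) y = c * h x y"
  and h_sym: "h y x = cnj (h x y)"
  using herm unfolding hermitian_form_def by blast+

lemma h_add_right: "h x (y + z) = h x y + h x z"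
  using h_add_left h_sym by (metis complex_cnj_add)

lemma h_smult_right: "h x (c *s y) = cnj c * h x y"
  using h_smult_left h_sym by (metis complex_cnj_mult)

lemma h_scaleR_left: "h (r *\<^sub>R x) y = of_real r * h x y"
  and h_scaleR_right: "h x (r *\<^sub>R y) = of_real r * h x y"
  by (simp_all add: scaleR_eq_smult h_smult_left h_smult_right)

lemma h_diff_left: "h (x - y) z = h x z - h y z"
  using h_add_left[of "x - y" y z] by simp

lemma h_diff_right: "h x (y - z) = h x y - h x z"
  using h_add_right[of x "y - z" z] by simp

lemma h_zero_left [simp]: "h 0 y = 0" and h_zero_right [simp]: "h y 0 = 0"
  using h_diff_left[of y y] h_diff_right[of y y y] by simp_all

lemmas h_simps = h_add_left h_add_right h_smult_left h_smult_right h_scaleR_left h_scaleR_right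
  h_diff_left h_diff_right

lemma h_sym_zero: "h x y = 0 \<Longrightarrow> h y x = 0"
  using h_sym[of y x] by simp

lemma b_add_left: "b (x + y) z = b x z + b y z"
  and b_add_right: "b x (y + z) = b x y + b x z"
  and b_diff_left: "b (x - y) z = b x z - b y z"
  and b_diff_right: "b x (y - z) = b x y - b x z"
  and b_scaleR_left: "b (r *\<^sub>R x) y = r * b x y"
  and b_scaleR_right: "b x (r *\<^sub>R y) = r * b x y"
  and b_zero: "b 0 y = 0"
  by (simp_all add: trace_form_def h_simps)

lemmas b_simps = b_add_left b_add_right b_diff_left b_diff_right b_scaleR_left b_scaleR_right b_zero

lemma b_sym: "b x y = b y x"
  by (simp add: trace_form_def h_sym[of x y])

text \<open>A Hermitian form is determined by its real part, since
  \<open>h x (\<i> *s y) = - \<i> * h x y\<close> has real part \<open>Im (h x y)\<close>.\<close>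

lemma h_conv_b: "h x y = Complex (b x y / 2) (b x (\<i> *s y) / 2)"
  by (simp add: trace_form_def h_simps complex_eq_iff)

lemma linear_b: "linear (\<lambda>x. b x y)"
  by (rule linearI) (simp_all add: b_simps)

lemma linear_smult: "linear (\<lambda>x :: complex ^ 'n. c *s x)"
  by (rule linearI) (simp_all add: vec_eq_iff algebra_simps)

lemma b_nondegenerate: "(\<And>y. b x y = 0) \<Longrightarrow> x = 0"
  by (rule nondegenerate) (simp add: h_conv_b complex_eq_iff)

lemma b_nondegenerate_V:
  assumes "\<And>y. y \<in> V \<Longrightarrow> b x y = 0"
  shows "x = 0"
proof (rule b_nondegenerate)
  fix y
  have "y \<in> span V" using V(2) by simp
  then have "b y x = 0"
    using linear_eq_on_span[OF linear_b linear_zero, of V x y] assms b_sym by simp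
  then show "b x y = 0" by (simp add: b_sym)
qed

lemma V_add: "x \<in> V \<Longrightarrow> y \<in> V \<Longrightarrow> x + y \<in> V"
  and V_smult: "c \<in> quad_field d \<Longrightarrow> x \<in> V \<Longrightarrow> c *s x \<in> V"
  using V(1) by (auto simp: submodule_over_def)

lemma V_scaleR: "r \<in> \<rat> \<Longrightarrow> x \<in> V \<Longrightarrow> r *\<^sub>R x \<in> V"
  unfolding scaleR_eq_smult using V_smult quad_field_Rats Rats_complex_iff by blast

lemma V_diff: "x \<in> V \<Longrightarrow> y \<in> V \<Longrightarrow> x - y \<in> V"
  using submodule_over_diff[OF V(1)] quad_field_Rats[of "-1" d] by simp

lemma e_in_V: "e \<in> V" using e J by blast

lemma b_rational: "x \<in> V \<Longrightarrow> y \<in> V \<Longrightarrow> b x y \<in> \<rat>"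
  unfolding trace_form_def using quad_field_trace[OF d_neg] rational by blast

text \<open>A hyperbolic partner of \<open>e\<close>, in general not isotropic. Rationality matters:
  the projection \<open>x - h x e *s dual\<close> to the complement of \<open>e\<close> then
  preserves \<open>V\<close>.\<close>

definition dual :: "complex ^ 'n" where
  "dual = (SOME x. x \<in> V \<and> h x e = 1)"

lemma dual: "dual \<in> V" "h dual e = 1" "h e dual = 1"
proof -
  have "\<exists>x\<in>V. h x e \<noteq> 0"
  proof (rule ccontr)
    assume "\<not> ?thesis"
    then have "b e y = 0" if "y \<in> V" for y
      using that h_sym_zero by (simp add: trace_form_def)
    then show False using b_nondegenerate_V e by blast
  qed
  then obtain x where x: "x \<in> V" "h x e \<noteq> 0" by blast
  then have "inverse (h x e) *s x \<in> V \<and> h (inverse (h x e) *s x) e = 1"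
    by (simp add: h_simps V_smult quad_field_inverse d_neg rational e_in_V)
  then have "dual \<in> V \<and> h dual e = 1" unfolding dual_def by (rule someI)
  then show "dual \<in> V" "h dual e = 1" by blast+
  then show "h e dual = 1" using h_sym by (metis complex_cnj_one)
qed

text \<open>The coefficient can only be \<open>h x dual\<close>; the difference is tested on
  \<open>y\<close> after projecting \<open>y\<close> along \<open>dual\<close> into the complement
  of \<open>e\<close>.\<close>

lemma perp_perp:
  assumes "\<And>y. h y e = 0 \<Longrightarrow> h x y = 0"
  shows "\<exists>c. x = c *s e"
proof -
  have "x - h x dual *s e = 0"
  proof (rule nondegenerate)
    fix y
    let ?y = "y - h y e *s dual"
    have "h ?y e = 0" by (simp add: h_simps dual)
    then have "h x ?y = 0" "h e ?y = 0" using assms h_sym_zero by blast+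
    then have "h x y = cnj (h y e) * h x dual" "h e y = cnj (h y e)"
      by (simp_all add: h_simps dual)
    then show "h (x - h x dual *s e) y = 0" by (simp add: h_simps)
  qed
  then show ?thesis by (intro exI[of _ "h x dual"]) simp
qed

text \<open>The complement of \<open>e\<close> is stable under \<open>\<i>\<close>, so orthogonality
  to it for the trace form upgrades to orthogonality for \<open>h\<close>.\<close>

lemma perp_perp_b:
  assumes "\<And>y. h y e = 0 \<Longrightarrow> b x y = 0"
  shows "\<exists>c. x = c *s e"
proof (rule perp_perp)
  fix y assume "h y e = 0"
  then have "b x y = 0" "b x (\<i> *s y) = 0" using assms by (simp_all add: h_simps)
  then show "h x y = 0" by (simp add: h_conv_b complex_eq_iff)
qed

lemma perp_iff_b: "h x e = 0 \<longleftrightarrow> (\<forall>c. b x (c *s e) = 0)"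
proof
  assume "\<forall>c. b x (c *s e) = 0"
  then have "b x (1 *s e) = 0" "b x (\<i> *s e) = 0" by blast+
  then show "h x e = 0" by (simp add: h_conv_b complex_eq_iff)
qed (simp add: trace_form_def h_simps)

text \<open>The projection along the rational vector \<open>dual\<close> maps the spanning set
  \<open>V\<close> to rational points of the hyperplane and is the identity on the
  hyperplane.\<close>

lemma perp_subset_span: "{x. h x e = 0} \<subseteq> span {x \<in> V. h x e = 0}"
proof
  fix x assume x: "x \<in> {x. h x e = 0}"
  define p where "p = (\<lambda>x. x - h x e *s dual)"
  have "linear p"
    by (rule linearI) (simp_all add: p_def h_simps scaleR_eq_smult vec_eq_iff algebra_simps)
  have "p ` V \<subseteq> {x \<in> V. h x e = 0}"
    by (auto simp: p_def h_simps dual intro!: V_diff V_smult rational e_in_V)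
  then have "span (p ` V) \<subseteq> span {x \<in> V. h x e = 0}" by (rule span_mono)
  moreover have "p x \<in> p ` span V" using V(2) by simp
  then have "p x \<in> span (p ` V)" using linear_span_image[OF \<open>linear p\<close>, of V] by simp
  moreover have "p x = x" using x by (simp add: p_def)
  ultimately show "x \<in> span {x \<in> V. h x e = 0}" by auto
qed

lemma linear_on_line:
  assumes "linear g" "Im z \<noteq> 0"
  shows "g (c *s v) = (Re c - Im c / Im z * Re z) *\<^sub>R g v + (Im c / Im z) *\<^sub>R g (z *s v)"
proof -
  have "c *s v = (Re c - Im c / Im z * Re z) *\<^sub>R v + (Im c / Im z) *\<^sub>R (z *s v)"
    unfolding scaleR_eq_smult vec.scale_scale vec.scale_left_distrib[symmetric]
    using complex_real_combination[OF assms(2), of c] by simp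
  then show ?thesis using assms(1) by (simp add: linear_add linear_cmul)
qed

section \<open>The stabilizer \<open>G\<close> and the subgroup \<open>U\<close> acting trivially on
  the graded pieces\<close>

definition G :: "(complex ^ 'n \<Rightarrow> complex ^ 'n) set" where
  "G = {g \<in> orthogonal_plus b D V. g ` J = J}"

lemma GD:
  assumes "g \<in> G"
  shows "linear g" "b (g x) (g y) = b x y" "g ` V = V" "g ` J = J"
    "(\<lambda>l. map_prod g g ` l) ` D = D"
  using assms by (auto simp: G_def orthogonal_plus_def orthogonal_group_def)

lemma G_compose:
  assumes "f \<in> G" "g \<in> G"
  shows "f \<circ> g \<in> G"
proof -
  have "(\<lambda>l. map_prod (f \<circ> g) (f \<circ> g) ` l) ` D = (\<lambda>l. map_prod f f ` l) ` (\<lambda>l. map_prod g g ` l) ` D"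
    by (simp add: image_image map_prod.comp[symmetric])
  also have "\<dots> = D" by (simp only: GD(5)[OF assms(1)] GD(5)[OF assms(2)])
  finally have "(\<lambda>l. map_prod (f \<circ> g) (f \<circ> g) ` l) ` D = D" .
  moreover have "(f \<circ> g) ` V = V" "(f \<circ> g) ` J = J"
    by (simp_all only: image_comp[symmetric] GD(3,4)[OF assms(1)] GD(3,4)[OF assms(2)])
  ultimately show ?thesis
    using GD(1,2)[OF assms(1)] GD(1,2)[OF assms(2)] linear_compose[of g f]
    by (simp add: G_def orthogonal_plus_def orthogonal_group_def)
qed

lemma G_id: "id \<in> G"
  by (simp add: G_def orthogonal_plus_def orthogonal_group_def linear_id map_prod.id)

lemma G_inverse:
  assumes "g \<in> G"
  obtains g' where "g' \<in> G" "g' \<circ> g = id" "g \<circ> g' = id"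
proof -
  note g = GD[OF assms]
  have "inj g" unfolding linear_injective_0[OF g(1)]
  proof (intro allI impI)
    fix x assume "g x = 0"
    then have "b x y = 0" for y using g(2)[of x y] by (simp add: b_zero)
    then show "x = 0" by (rule b_nondegenerate)
  qed
  then obtain g' where g': "linear g'" "\<And>x. g' (g x) = x" "\<And>x. g (g' x) = x"
    using linear_injective_isomorphism[OF g(1)] by metis
  have inv: "g' ` S = S" if "g ` S = S" for S
  proof -
    have "g' ` g ` S = S" using g'(2) by (simp add: image_image)
    then show ?thesis using that by simp
  qed
  have "(\<lambda>l. map_prod g' g' ` l) ` (\<lambda>l. map_prod g g ` l) ` D = D"
    by (simp add: image_image map_prod_def case_prod_beta g'(2))
  then have "(\<lambda>l. map_prod g' g' ` l) ` D = D" by (simp only: g(5))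
  moreover have "b (g' x) (g' y) = b x y" for x y using g(2)[of "g' x" "g' y"] g'(3) by simp
  ultimately have "g' \<in> G"
    using g'(1) inv g(3,4) by (simp add: G_def orthogonal_plus_def orthogonal_group_def)
  then show ?thesis using that g' by (simp add: fun_eq_iff)
qed

lemma group_G: "group (comp_group G)"
  using G_compose G_id G_inverse by (intro group_comp_group) blast+

text \<open>\<open>J\<close> contains \<open>e\<close> and \<open>csqrt (of_int d) *s e\<close>, a
  real basis of the complex line. Since \<open>g\<close> is only real linear, \<open>c'\<close> need
  not be a fixed multiple of \<open>c\<close>.\<close>

lemma G_line:
  assumes "g \<in> G"
  shows "\<exists>c'. g (c *s e) = c' *s e"
proof -
  have "csqrt (of_int d) *s e \<in> J"
    using J(1) e(1) csqrt_in_quad_field by (auto simp: submodule_over_def)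
  then have "g e \<in> J" "g (csqrt (of_int d) *s e) \<in> J" using GD(4)[OF assms] e(1) by blast+
  then obtain p q where pq: "g e = p *s e" "g (csqrt (of_int d) *s e) = q *s e" using J(3) by meson
  have "Im (csqrt (of_int d)) \<noteq> 0" using Im_csqrt_neg[OF d_neg] by simp
  from linear_on_line[OF GD(1)[OF assms] this, of c e]
  show ?thesis
    by (auto simp only: pq scaleR_eq_smult vec.scale_scale vec.scale_left_distrib[symmetric])
qed

lemma G_perp:
  assumes "g \<in> G" "h x e = 0"
  shows "h (g x) e = 0"
proof -
  obtain g' where g': "g' \<in> G" "g \<circ> g' = id" using G_inverse[OF assms(1)] by metis
  have "b (g x) (c *s e) = 0" for c
  proof -
    obtain c' where "g' (c *s e) = c' *s e" using G_line[OF g'(1)] by blast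
    then have "c *s e = g (c' *s e)" using g'(2) by (metis comp_apply id_apply)
    then show ?thesis using GD(2)[OF assms(1)] assms(2) perp_iff_b by metis
  qed
  then show ?thesis using perp_iff_b by blast
qed

lemma G_one_parameter:
  fixes f :: "real \<Rightarrow> complex ^ 'n \<Rightarrow> complex ^ 'n"
  assumes "\<And>t. linear (f t)" "\<And>t x y. b (f t x) (f t y) = b x y"
    and "\<And>x. f 0 x = x" "\<And>s t x. f (s + t) x = f s (f t x)"
    and "\<And>x. continuous_on UNIV (\<lambda>t. f t x)"
    and "\<And>x. x \<in> V \<Longrightarrow> f t x \<in> V" "\<And>x. x \<in> V \<Longrightarrow> f (-t) x \<in> V" "f t ` J = J"
  shows "f t \<in> G"
  using orthogonal_plus_one_parameter[OF D assms(1-5), of t V] assms(6-8)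
  by (auto simp: G_def)

text \<open>The filtration is 0, the line of \<open>e\<close>, its orthogonal complement, the whole
  space. Triviality on the top quotient follows from triviality on the line by duality, see
  \<open>U_h\<close>.\<close>

definition U :: "(complex ^ 'n \<Rightarrow> complex ^ 'n) set" where
  "U = {g \<in> G. (\<forall>c. g (c *s e) = c *s e) \<and> (\<forall>x. h x e = 0 \<longrightarrow> (\<exists>c. g x - x = c *s e))}"

lemma UD:
  assumes "g \<in> U"
  shows "g \<in> G" "g (c *s e) = c *s e" "h x e = 0 \<Longrightarrow> \<exists>c. g x - x = c *s e"
  using assms by (auto simp: U_def)

lemma line_perp: "h (c *s e) e = 0"
  by (simp add: h_simps isotropic)

lemma U_h:
  assumes "g \<in> U"
  shows "h (g x) e = h x e"
proof -
  have "b (g x) (c *s e) = b x (c *s e)" for c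
    using GD(2)[OF UD(1)[OF assms], of x "c *s e"] UD(2)[OF assms] by simp
  from this[of 1] this[of \<i>] show ?thesis by (simp add: h_conv_b)
qed

text \<open>\<open>g - 1\<close> moves every vector one step down the filtration, which has three
  steps.\<close>

lemma U_nilpotent:
  assumes "g \<in> U"
  defines "N \<equiv> \<lambda>x. g x - x"
  shows "N (N (N x)) = 0"
proof -
  have "h (N x) e = 0" by (simp add: N_def h_simps U_h[OF assms(1)])
  then obtain c where "N (N x) = c *s e" using UD(3)[OF assms(1)] N_def by metis
  then show ?thesis by (simp add: N_def UD(2)[OF assms(1)])
qed

lemma J_fixed: "(\<And>c. g (c *s e) = c *s e) \<Longrightarrow> g ` J = J"
  using J(3) by (metis image_cong image_ident)

lemma U_intro_one_parameter:
  fixes f :: "real \<Rightarrow> complex ^ 'n \<Rightarrow> complex ^ 'n"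
  assumes "\<And>t. linear (f t)" "\<And>t x y. b (f t x) (f t y) = b x y"
    and "\<And>x. f 0 x = x" "\<And>s t x. f (s + t) x = f s (f t x)"
    and "\<And>x. continuous_on UNIV (\<lambda>t. f t x)"
    and "\<And>x. x \<in> V \<Longrightarrow> f t x \<in> V" "\<And>x. x \<in> V \<Longrightarrow> f (-t) x \<in> V"
    and "\<And>c. f t (c *s e) = c *s e" "\<And>x. h x e = 0 \<Longrightarrow> \<exists>c. f t x - x = c *s e"
  shows "f t \<in> U"
  using G_one_parameter[of f t] assms J_fixed[of "f t"] unfolding U_def by blast

subsection \<open>One-parameter subgroups\<close>

text \<open>Isometries fixing the hyperplane orthogonal to \<open>e\<close>; those preserving \<open>V\<close> form both centers.\<close>

definition transvection :: "real \<Rightarrow> complex ^ 'n \<Rightarrow> complex ^ 'n" where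
  "transvection t x = x + (\<i> * of_real t * h x e) *s e"

text \<open>The factor \<open>\<i> * of_real t\<close> is purely imaginary, so the two cross terms
  cancel; the remaining term contains \<open>h e e = 0\<close>.\<close>

lemma transvection_isometry: "h (transvection t x) (transvection t y) = h x y"
  by (simp add: transvection_def h_simps isotropic h_sym[of y e] algebra_simps)

lemma transvection_zero: "transvection 0 x = x"
  by (simp add: transvection_def)

lemma transvection_add: "transvection (s + t) x = transvection s (transvection t x)"
  by (simp add: transvection_def h_simps isotropic vec_eq_iff algebra_simps)

lemma transvection_perp: "h x e = 0 \<Longrightarrow> transvection t x = x"
  by (simp add: transvection_def)

lemma transvection_in_U:
  assumes "\<And>x. x \<in> V \<Longrightarrow> transvection t x \<in> V" "\<And>x. x \<in> V \<Longrightarrow> transvection (-t) x \<in> V"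
  shows "transvection t \<in> U"
proof (rule U_intro_one_parameter[of transvection])
  show "linear (transvection t)" for t
    by (rule linearI)
      (simp_all add: transvection_def h_simps scaleR_eq_smult vec_eq_iff algebra_simps)
  show "continuous_on UNIV (\<lambda>t. transvection t x)" for x
  proof -
    have "transvection t x = x + t *\<^sub>R ((\<i> * h x e) *s e)" for t
      by (simp add: transvection_def scaleR_eq_smult mult_ac)
    then show ?thesis by (simp add: continuous_intros)
  qed
  show "\<exists>c. transvection t x - x = c *s e" if "h x e = 0" for x
    using that by (intro exI[of _ 0]) (simp add: transvection_perp)
qed (use assms in \<open>auto simp: trace_form_def transvection_isometry transvection_zero
       transvection_add transvection_perp line_perp\<close>)

text \<open>The displacement of \<open>c *s dual\<close> is orthogonal to the complement of
  \<open>e\<close>, hence equals \<open>p c *s e\<close>. Isometry makes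
  \<open>Re (p c * cnj c')\<close> an alternating form in \<open>c\<close> and \<open>c'\<close> on
  a real plane, so one real number \<open>s\<close> determines it and
  \<open>p c = \<i> * s * c\<close>.\<close>

lemma isometry_fixing_perp:
  assumes g: "linear g" "\<And>x y. b (g x) (g y) = b x y" "\<And>x. h x e = 0 \<Longrightarrow> g x = x"
  shows "\<exists>s. g = transvection s"
proof -
  have "\<exists>p. g (c *s dual) - c *s dual = p *s e" for c
  proof (rule perp_perp_b)
    fix y assume "h y e = 0"
    then show "b (g (c *s dual) - c *s dual) y = 0"
      using g(2)[of "c *s dual" y] g(3)[of y] by (simp add: b_simps)
  qed
  then obtain p where p: "\<And>c. g (c *s dual) = c *s dual + p c *s e"
    by (metis add.commute diff_add_cancel)
  have pp: "Re (c * cnj (p c')) + Re (p c * cnj c') = 0" for c c'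
    using g(2)[of "c *s dual" "c' *s dual"]
    by (simp add: p trace_form_def h_simps dual isotropic algebra_simps)
  from pp[of 1 1] have 1: "Re (p 1) = 0" by simp
  from pp[of \<i> \<i>] have 2: "Im (p \<i>) = 0" by simp
  from pp[of 1 \<i>] have 3: "Re (p \<i>) = - Im (p 1)" by simp
  define s where "s = Im (p 1)"
  have s: "p 1 = \<i> * of_real s" "p \<i> = - of_real s"
    using 1 2 3 by (simp_all add: s_def complex_eq_iff)
  have gd: "g (c *s dual) = c *s dual + (\<i> * of_real s * c) *s e" for c
  proof -
    have "g (c *s dual) = Re c *\<^sub>R g (1 *s dual) + Im c *\<^sub>R g (\<i> *s dual)"
      using linear_on_line[OF g(1), of \<i> c dual] by simp
    also have "\<dots> = (of_real (Re c) + of_real (Im c) * \<i>) *s dual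
        + (\<i> * of_real s * (of_real (Re c) + of_real (Im c) * \<i>)) *s e"
      unfolding p s by (simp add: scaleR_eq_smult vec_eq_iff algebra_simps)
    also have "of_real (Re c) + of_real (Im c) * \<i> = c" by (simp add: complex_eq_iff)
    finally show ?thesis .
  qed
  have "g x = transvection s x" for x
  proof -
    have "g x = g (x - h x e *s dual) + g (h x e *s dual)"
      using g(1) by (metis diff_add_cancel linear_add)
    also have "g (x - h x e *s dual) = x - h x e *s dual"
      by (rule g(3)) (simp add: h_simps dual)
    finally show ?thesis by (simp add: gd transvection_def)
  qed
  then show ?thesis by blast
qed

text \<open>The Eichler transvection of the real quadratic space for the isotropic vector
  \<open>f\<close> and the vector \<open>t *\<^sub>R m\<close> orthogonal to it; the term in
  \<open>t^2 / 2\<close> compensates the norm of \<open>m\<close>.\<close>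

definition eichler :: "complex ^ 'n \<Rightarrow> complex ^ 'n \<Rightarrow> real \<Rightarrow> complex ^ 'n \<Rightarrow> complex ^ 'n" where
  "eichler f m t x =
     x - (t * b m x) *\<^sub>R f + (t * b f x) *\<^sub>R m - (t^2 / 2 * b m m * b f x) *\<^sub>R f"

text \<open>On the complement of \<open>e\<close> the form \<open>b f\<close> vanishes, so only a
  multiple of \<open>f\<close> is added. The flow is isometric for every real \<open>t\<close> and
  preserves \<open>V\<close> for rational \<open>t\<close>, in particular for 1 and -1.\<close>

lemma eichler_in_U:
  assumes f: "f \<in> J" and m: "m \<in> V" "h m e = 0"
  shows "eichler f m 1 \<in> U"
proof (rule U_intro_one_parameter[of "eichler f m"])
  obtain c where c: "f = c *s e" using J(3)[OF f] by blast
  have bf: "b f (c' *s e) = 0" "b m (c' *s e) = 0" for c'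
    by (simp_all add: c trace_form_def h_simps isotropic m(2))
  have bm: "b f m = 0" "b m f = 0" "b f f = 0" using bf(1,2)[of c] b_sym c by metis+
  show lin: "linear (eichler f m t)" for t
    by (rule linearI) (simp_all add: eichler_def b_simps algebra_simps add_divide_distrib)
  show "b (eichler f m t x) (eichler f m t y) = b x y" for t x y
    using b_sym[of x f] b_sym[of x m]
    by (simp add: eichler_def b_simps bm algebra_simps power2_eq_square)
  show "eichler f m 0 x = x" for x by (simp add: eichler_def)
  show "eichler f m (s + t) x = eichler f m s (eichler f m t x)" for s t x
    by (simp add: eichler_def b_simps bm algebra_simps power2_eq_square
        flip: scaleR_add_left scaleR_diff_left)
  show "continuous_on UNIV (\<lambda>t. eichler f m t x)" for x
    unfolding eichler_def by (intro continuous_intros) simp_all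
  have "eichler f m t x \<in> V" if "t \<in> \<rat>" "x \<in> V" for t x
    unfolding eichler_def using that m f J(2)
    by (intro V_add V_diff V_scaleR Rats_mult Rats_divide Rats_power b_rational) auto
  then show "eichler f m 1 x \<in> V" "eichler f m (- 1) x \<in> V" if "x \<in> V" for x
    using that by simp_all
  show "eichler f m 1 (c' *s e) = c' *s e" for c' by (simp add: eichler_def bf)
  show "\<exists>c'. eichler f m 1 x - x = c' *s e" if "h x e = 0" for x
  proof -
    have "b f x = 0" using that by (simp add: c trace_form_def h_simps h_sym_zero)
    then show ?thesis
      by (intro exI[of _ "- of_real (b m x) * c"]) (simp add: eichler_def c scaleR_eq_smult vec_eq_iff)
  qed
qed

text \<open>The circle of scalars of modulus 1 connects \<open>z\<close> to the identity. At
  parameters 1 and -1 the scalars are \<open>z\<close> and \<open>cnj z\<close>, which lie in the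
  field.\<close>

lemma scalar_in_G:
  assumes z: "z \<in> quad_field d" "cmod z = 1"
  shows "(\<lambda>x. z *s x) \<in> G"
proof -
  define f where "f = (\<lambda>t x. cis (Arg z * t) *s (x :: complex ^ 'n))"
  have cis: "cis (Arg z) = z" using z(2) by (metis cis_Arg norm_zero sgn_div_norm zero_neq_one
    div_by_1 scaleR_one inverse_1 )
  have zi: "cis (- Arg z) = cnj z" by (metis cis cis_cnj)
  have zc: "z * cnj z = 1" using z(2) by (metis complex_norm_square of_real_1 power_one)
  have "f 1 \<in> G"
  proof (rule G_one_parameter)
    show "linear (f t)" for t unfolding f_def by (rule linear_smult)
    show "b (f t x) (f t y) = b x y" for t x y
    proof -
      have "cis (Arg z * t) * cnj (cis (Arg z * t)) = 1" by (simp add: cis_cnj cis_mult)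
      then show ?thesis by (simp add: f_def trace_form_def h_simps mult.assoc[symmetric])
    qed
    show "f 0 x = x" for x by (simp add: f_def)
    show "f (s + t) x = f s (f t x)" for s t x by (simp add: f_def cis_mult algebra_simps)
    show "continuous_on UNIV (\<lambda>t. f t x)" for x
      unfolding f_def vector_scalar_mult_def by (intro continuous_intros)
    show "f 1 x \<in> V" "f (- 1) x \<in> V" if "x \<in> V" for x
      using that z(1) by (simp_all add: f_def cis zi V_smult quad_field_cnj d_neg)
    have "z *s x \<in> J" "cnj z *s x \<in> J" if "x \<in> J" for x
      using that z(1) J(1) quad_field_cnj[OF d_neg] unfolding submodule_over_def by blast+
    moreover have "x = z *s (cnj z *s x)" for x :: "complex ^ 'n" using zc by simp
    ultimately have "(\<lambda>x. z *s x) ` J = J" by blast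
    then show "f 1 ` J = J" by (simp add: f_def cis)
  qed
  then show ?thesis by (simp add: f_def cis)
qed

subsection \<open>The candidate for the unipotent radical\<close>

definition unipotent_power :: "(complex ^ 'n \<Rightarrow> complex ^ 'n) \<Rightarrow> real \<Rightarrow> complex ^ 'n \<Rightarrow> complex ^ 'n" where
  "unipotent_power g t x = x + t *\<^sub>R (g x - x) + (t * (t - 1) / 2) *\<^sub>R (g (g x - x) - (g x - x))"

lemma unipotent_power_0: "unipotent_power g 0 = id" and unipotent_power_1: "unipotent_power g 1 = g"
  by (simp_all add: unipotent_power_def fun_eq_iff)

text \<open>On \<open>U\<close> we have \<open>(g - 1)\<^sup>3 = 0\<close>, so \<open>unipotent_power g t\<close> is the binomial series of \<open>(1 + (g - 1))\<^sup>t\<close>.\<close>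

lemma unipotent_power_in_U:
  assumes g: "g \<in> U" and t: "t \<in> \<rat>"
  shows "unipotent_power g t \<in> U"
proof -
  note G = GD[OF UD(1)[OF g]]
  define N where "N = (\<lambda>x. g x - x)"
  have power: "unipotent_power g t x = x + t *\<^sub>R N x + (t * (t - 1) / 2) *\<^sub>R N (N x)" for t x
    by (simp add: unipotent_power_def N_def)
  have N: "linear N" unfolding N_def
    by (rule linearI) (simp_all add: linear_add[OF G(1)] linear_cmul[OF G(1)] algebra_simps)
  have "N (N (N x)) = 0" for x using U_nilpotent[OF g, of x] by (simp only: N_def)
  note Ns = linear_add[OF N] linear_cmul[OF N] this linear_0[OF N]
  have NV: "N x \<in> V" if "x \<in> V" for x using that G(3) by (auto simp: N_def intro: V_diff)
  have isom: "b (N x) y + b x (N y) + b (N x) (N y) = 0" for x y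
    using G(2)[of x y] by (simp add: N_def b_simps)
  have b_zero': "b x 0 = 0" for x using b_zero[of x] b_sym by metis
  show ?thesis
  proof (rule U_intro_one_parameter[of "unipotent_power g"])
    show "linear (unipotent_power g t)" for t
      by (rule linearI) (simp_all add: power Ns algebra_simps)
    show "b (unipotent_power g t x) (unipotent_power g t y) = b x y" for t x y
    proof -
      \<comment> \<open>As \<open>N\<close> has cube zero, all pairings of total degree above two in
        \<open>N\<close> vanish, and those left contribute multiples of \<open>?a\<close> with
        factors \<open>-t\<close>, \<open>t^2\<close> and \<open>-t * (t - 1)\<close>, whose sum is
        0.\<close>
      let ?a = "b (N x) (N y)"
      have "b (N (N x)) (N y) = 0" "b (N x) (N (N y)) = 0" "b (N (N x)) (N (N y)) = 0"
        using isom[of "N (N x)" y] isom[of x "N (N y)"] isom[of "N (N x)" "N y"]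
        by (simp_all add: Ns b_zero b_zero')
      moreover from this have "b (N (N x)) y = - ?a" "b x (N (N y)) = - ?a" "b (N x) y + b x (N y) = - ?a"
        using isom[of "N x" y] isom[of x "N y"] isom[of x y] by linarith+
      moreover from this(3) have "b (N x) y = - ?a - b x (N y)" by linarith
      ultimately show ?thesis
        by (simp add: power b_simps) (simp add: field_simps)
    qed
    show "unipotent_power g 0 x = x" for x by (simp add: unipotent_power_0)
    show "unipotent_power g (s + t) x = unipotent_power g s (unipotent_power g t x)" for s t x
    proof -
      \<comment> \<open>Vandermonde's identity for the second binomial coefficient of
        \<open>s + t\<close>.\<close>
      have E: "(s + t) * (s + t - 1) / 2 = s * (s - 1) / 2 + t * (t - 1) / 2 + s * t"
        by (simp add: field_simps)
      show ?thesis unfolding power E by (simp add: Ns scaleR_add_left scaleR_add_right)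
    qed
    show "continuous_on UNIV (\<lambda>t. unipotent_power g t x)" for x
      unfolding unipotent_power_def by (intro continuous_intros) simp_all
    have *: "unipotent_power g t x \<in> V" if "t \<in> \<rat>" "x \<in> V" for t x
      unfolding power using that NV
      by (intro V_add V_scaleR Rats_mult Rats_divide Rats_diff) auto
    show "unipotent_power g t x \<in> V" "unipotent_power g (- t) x \<in> V" if "x \<in> V" for x
      using * that t by auto
    show "unipotent_power g t (c *s e) = c *s e" for c
      by (simp add: unipotent_power_def UD(2)[OF g] linear_0[OF G(1)])
    show "\<exists>c. unipotent_power g t x - x = c *s e" if x: "h x e = 0" for x
    proof -
      obtain c where c: "N x = c *s e" using UD(3)[OF g x] N_def by metis
      then have "N (N x) = 0" by (simp add: N_def UD(2)[OF g])
      then show ?thesis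
        by (intro exI[of _ "of_real t * c"]) (simp add: power c scaleR_eq_smult vec_eq_iff)
    qed
  qed
qed

text \<open>\<open>G\<close> preserves the line and its complement (\<open>G_line\<close>,
  \<open>G_perp\<close>), and acting trivially on the graded pieces of an invariant filtration is
  stable under conjugation.\<close>

lemma U_normal: "U \<lhd> comp_group G"
proof -
  interpret group "comp_group G" by (rule group_G)
  have inv: "inv\<^bsub>comp_group G\<^esub> g \<in> G" "g ((inv\<^bsub>comp_group G\<^esub> g) x) = x"
    "(inv\<^bsub>comp_group G\<^esub> g) (g x) = x" if "g \<in> G" for g x
    using inv_closed[of g] r_inv[of g] l_inv[of g] that by (simp_all add: fun_eq_iff)
  have "subgroup U (comp_group G)"
  proof
    show "U \<subseteq> carrier (comp_group G)" using UD(1) by auto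
    show "\<one>\<^bsub>comp_group G\<^esub> \<in> U" using G_id by (auto simp: U_def intro: exI[of _ 0])
  next
    fix f g assume f: "f \<in> U" and g: "g \<in> U"
    have "\<exists>c. f (g x) - x = c *s e" if x: "h x e = 0" for x
    proof -
      have "h (g x) e = 0" using U_h[OF g] x by simp
      then obtain c c' where "f (g x) - g x = c *s e" "g x - x = c' *s e"
        using UD(3) f g x by meson
      moreover have "f (g x) - x = (f (g x) - g x) + (g x - x)" by simp
      ultimately have "f (g x) - x = (c + c') *s e" by (simp only: vec.scale_left_distrib)
      then show ?thesis by blast
    qed
    then show "f \<otimes>\<^bsub>comp_group G\<^esub> g \<in> U"
      using G_compose[OF UD(1)[OF f] UD(1)[OF g]]
      by (simp add: U_def UD(2)[OF f] UD(2)[OF g])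
  next
    fix g assume g: "g \<in> U"
    let ?g = "inv\<^bsub>comp_group G\<^esub> g"
    note inv = inv[OF UD(1)[OF g]]
    have "?g (c *s e) = c *s e" for c using inv(3) UD(2)[OF g] by metis
    moreover have "\<exists>c. ?g x - x = c *s e" if "h x e = 0" for x
    proof -
      have "h (?g x) e = 0" using U_h[OF g, of "?g x"] that inv(2) by simp
      then obtain c where "g (?g x) - ?g x = c *s e" using UD(3)[OF g] by blast
      then have "?g x - x = (- c) *s e" using inv(2)[of x] by (simp add: algebra_simps)
      then show ?thesis by blast
    qed
    ultimately show "?g \<in> U" using inv(1) by (simp add: U_def)
  qed
  then show ?thesis
  proof (rule normal_invI)
    fix g u assume g: "g \<in> carrier (comp_group G)" and u: "u \<in> U"
    let ?g = "inv\<^bsub>comp_group G\<^esub> g"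
    have gG: "g \<in> G" using g by simp
    note inv = inv[OF gG]
    have "g (u (?g (c *s e))) = c *s e" for c
      using G_line[OF inv(1), of c] UD(2)[OF u] inv(2) by metis
    moreover have "\<exists>c. g (u (?g x)) - x = c *s e" if x: "h x e = 0" for x
    proof -
      obtain c where "u (?g x) - ?g x = c *s e" using UD(3)[OF u] G_perp[OF inv(1) x] by blast
      then have "g (u (?g x)) - g (?g x) = g (c *s e)"
        using linear_diff[OF GD(1)[OF gG]] by metis
      then show ?thesis using inv(2) G_line[OF gG] by simp
    qed
    ultimately show "g \<otimes>\<^bsub>comp_group G\<^esub> u \<otimes>\<^bsub>comp_group G\<^esub> ?g \<in> U"
      using gG inv(1) UD(1)[OF u] G_compose by (simp add: U_def)
  qed
qed

lemma entry_polynomial: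
  assumes "x \<in> V" "y \<in> V"
  shows "(\<lambda>g. b (g x) y - b x y) \<in> matrix_polynomials V"
proof -
  have "(\<lambda>g. b (g x) y) \<in> matrix_polynomials V"
    using assms b_rational by (intro matrix_polynomials.entry[OF _ linear_b]) auto
  moreover have "(\<lambda>g. - b x y) \<in> matrix_polynomials V"
    using assms b_rational by (intro matrix_polynomials.const) simp
  ultimately show ?thesis using matrix_polynomials.add by fastforce
qed

text \<open>The equations \<open>b (g x) y = b x y\<close> over the rational pairs in
  \<open>K\<close> cut out \<open>U\<close>: with \<open>x\<close> in \<open>J\<close> and any
  \<open>y\<close> they make \<open>g\<close> fix \<open>J\<close>, and with both vectors in the
  complement of \<open>e\<close> they push the displacement into the double complement, the
  line.\<close>

lemma U_closed: "closedin (subtopology (zariski_topology V) G) U"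
proof -
  define K where "K = {(x, y). x \<in> V \<and> y \<in> V \<and> (x \<in> J \<or> h x e = 0 \<and> h y e = 0)}"
  have "closedin (zariski_topology V) {g. b (g x) y = b x y}" if "(x, y) \<in> K" for x y
    using closedin_zariski_topology_zero[OF entry_polynomial[of x y]] that by (simp add: K_def)
  moreover have "(e, e) \<in> K" using e e_in_V by (simp add: K_def)
  ultimately have "closedin (zariski_topology V) (\<Inter>(x, y)\<in>K. {g. b (g x) y = b x y})"
    by (intro closedin_Inter) auto
  moreover have "U = (\<Inter>(x, y)\<in>K. {g. b (g x) y = b x y}) \<inter> G"
  proof (intro equalityI subsetI)
    fix g assume g: "g \<in> U"
    have "b (g x) y = b x y" if xy: "(x, y) \<in> K" for x y
    proof (cases "x \<in> J")
      case True
      then show ?thesis using J(3) UD(2)[OF g] by metis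
    next
      case False
      then have perp: "h x e = 0" "h y e = 0" using xy by (auto simp: K_def)
      then obtain c where "g x - x = c *s e" using UD(3)[OF g] by blast
      then have "b (g x - x) y = 0" using perp by (simp add: trace_form_def h_simps h_sym_zero)
      then show ?thesis by (simp add: b_simps)
    qed
    then show "g \<in> (\<Inter>(x, y)\<in>K. {g. b (g x) y = b x y}) \<inter> G" using UD(1)[OF g] by auto
  next
    fix g assume "g \<in> (\<Inter>(x, y)\<in>K. {g. b (g x) y = b x y}) \<inter> G"
    then have g: "g \<in> G" and eq: "\<And>x y. (x, y) \<in> K \<Longrightarrow> b (g x - x) y = 0"
      by (auto simp: b_simps)
    have fix_J: "g x = x" if "x \<in> J" for x
      using b_nondegenerate_V[of "g x - x"] eq[of x] that J(2) by (auto simp: K_def)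
    have "csqrt (of_int d) *s e \<in> J"
      using J(1) e(1) csqrt_in_quad_field by (auto simp: submodule_over_def)
    then have "g (c *s e) = c *s e" for c
      using linear_on_line[OF GD(1)[OF g], of "csqrt (of_int d)" c e]
        linear_on_line[OF linear_ident, of "csqrt (of_int d)" c e]
        fix_J e(1) Im_csqrt_neg[OF d_neg] by simp
    moreover have "\<exists>c. g x - x = c *s e" if "h x e = 0" for x
    proof (rule perp_perp_b)
      fix y assume y: "h y e = 0"
      have l: "linear (\<lambda>x. b (g x - x) y)" for y
        using linear_compose[OF linear_compose_sub[OF GD(1)[OF g] linear_ident] linear_b[of y]]
        by (simp add: comp_def)
      \<comment> \<open>The equations hold for rational vectors of the hyperplane; they are extended
        to real ones in \<open>x\<close>, then in \<open>y\<close>.\<close>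
      have *: "b (g x - x) y' = 0" if y': "y' \<in> V" "h y' e = 0" for y'
      proof -
        have "x \<in> span {x \<in> V. h x e = 0}" using \<open>h x e = 0\<close> perp_subset_span by blast
        then show ?thesis
          using linear_eq_on_span[OF l linear_zero, of "{x \<in> V. h x e = 0}" y' x] eq y'
          by (auto simp: K_def)
      qed
      have "y \<in> span {x \<in> V. h x e = 0}" using y perp_subset_span by blast
      then have "b y (g x - x) = 0"
        using linear_eq_on_span[OF linear_b linear_zero, of "{x \<in> V. h x e = 0}" "g x - x" y] * b_sym
        by auto
      then show "b (g x - x) y = 0" using b_sym by simp
    qed
    ultimately show "g \<in> U" using g by (simp add: U_def)
  qed
  ultimately show ?thesis unfolding closedin_subtopology by blast
qed

text \<open>The rational powers of \<open>g\<close> form a curve through \<open>id\<close> at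
  \<open>t = 0\<close> and \<open>g\<close> at \<open>t = 1\<close>. Matrix entries along it are
  quadratic in \<open>t\<close>, and curves with the common point \<open>id\<close> have a connected
  union.\<close>

lemma U_connected: "connectedin (zariski_topology V) U"
proof -
  have "connectedin (zariski_topology V) (unipotent_power g ` \<rat>)" for g
  proof (rule connectedin_zariski_topology_curve)
    fix p assume "p \<in> matrix_polynomials V"
    then show "\<exists>P. \<forall>t. p (unipotent_power g t) = poly P t"
    proof induction
      case (entry x f)
      let ?y = "g x - x" let ?z = "g ?y - ?y"
      have "f (unipotent_power g t x) = f x + t * f ?y + (t * (t - 1) / 2) * f ?z" for t
        unfolding unipotent_power_def using entry(2) by (simp only: linear_add linear_cmul real_scaleR_def)
      then have "f (unipotent_power g t x) = poly [:f x, f ?y - f ?z / 2, f ?z / 2:] t" for t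
        by (simp add: field_simps)
      then show ?case by blast
    next
      case (const c)
      have "c = poly [:c:] t" for t by simp
      then show ?case by blast
    next
      case (add p q)
      then show ?case by (metis poly_add)
    next
      case (mult p q)
      then show ?case by (metis poly_mult)
    qed
  qed
  then have "connectedin (zariski_topology V) (\<Union>g\<in>U. unipotent_power g ` \<rat>)"
  proof (intro connectedin_Union)
    have "id \<in> unipotent_power g ` \<rat>" for g using unipotent_power_0[of g] Rats_0 by (metis imageI)
    then show "(\<Inter>g\<in>U. unipotent_power g ` \<rat>) \<noteq> {}" by blast
  qed blast
  moreover have "U = (\<Union>g\<in>U. unipotent_power g ` \<rat>)"
  proof (intro equalityI subsetI)
    fix g assume "g \<in> U"
    moreover have "g \<in> unipotent_power g ` \<rat>" using unipotent_power_1[of g] Rats_1 by (metis imageI)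
    ultimately show "g \<in> (\<Union>g\<in>U. unipotent_power g ` \<rat>)" by (rule UN_I[of g U])
  next
    fix f assume "f \<in> (\<Union>g\<in>U. unipotent_power g ` \<rat>)"
    then obtain g t where "g \<in> U" "t \<in> \<rat>" "f = unipotent_power g t" by auto
    then show "f \<in> U" using unipotent_power_in_U by simp
  qed
  ultimately show ?thesis by simp
qed

lemma U_unipotent: "g \<in> U \<Longrightarrow> unipotent g"
  unfolding unipotent_def by (intro exI[of _ 3]) (simp add: numeral_3_eq_3 U_nilpotent)

subsection \<open>Normal unipotent subgroups\<close>

text \<open>The form is definite on the quotient of the orthogonal complement of \<open>e\<close> by the line of \<open>e\<close>.\<close>

lemma unipotent_perp:
  assumes g: "g \<in> G" "unipotent g" and x: "h x e = 0"
  shows "\<exists>c. g x - x = c *s e"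
proof -
  define N where "N = (\<lambda>x. g x - x)"
  have NP: "h (N u) e = 0" if "h u e = 0" for u
    using G_perp[OF g(1) that] that by (simp add: N_def h_simps)
  \<comment> \<open>Invariance of \<open>b\<close> on \<open>u\<close> and \<open>N u\<close> yields
    \<open>b (N u) (N u) = 0\<close> once \<open>N (N u)\<close> is on the line, and definiteness
    then puts \<open>N u\<close> there. Applied repeatedly, this descends from the iterate that
    vanishes.\<close>
  have step: "\<exists>c. N u = c *s e" if u: "h u e = 0" and NN: "\<exists>c. N (N u) = c *s e" for u
  proof -
    obtain c where c: "N (N u) = c *s e" using NN by blast
    let ?w = "N u"
    have w: "h ?w e = 0" by (rule NP[OF u])
    have "b (g u) (g ?w) = b u ?w" by (rule GD(2)[OF g(1)])
    moreover have "g u = u + ?w" by (simp add: N_def)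
    moreover have "g ?w = ?w + c *s e" using c by (simp add: N_def algebra_simps)
    moreover have "b u (c *s e) = 0" "b ?w (c *s e) = 0" using u w by (auto simp: perp_iff_b)
    ultimately have "b ?w ?w = 0" by (simp add: b_simps)
    then show ?thesis using definite[OF w] by (simp add: trace_form_def)
  qed
  have "\<exists>c. N u = c *s e" if "h u e = 0" "\<exists>c. (N ^^ k) (N u) = c *s e" for k u
    using that
  proof (induction k arbitrary: u)
    case (Suc k)
    then have "\<exists>c. (N ^^ k) (N (N u)) = c *s e" by (simp add: funpow_swap1)
    then show ?case using Suc.IH[of "N u"] NP Suc.prems(1) step by blast
  qed simp
  moreover obtain k where "(N ^^ k) (N x) = 0" using g(2) unfolding unipotent_def N_def by blast
  ultimately show ?thesis using x by (metis N_def vector_smult_lzero)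
qed

text \<open>A nontrivial unipotent map of the real plane spanned by \<open>e\<close> and its conjugate by a nonreal scalar
  have different fixed lines, so their product is not unipotent.\<close>

lemma normal_unipotent_line:
  assumes N: "N \<lhd> comp_group G" "\<And>g. g \<in> N \<Longrightarrow> unipotent g" and g: "g \<in> N"
  shows "g (c *s e) = c *s e"
proof (rule ccontr)
  assume neq: "g (c *s e) \<noteq> c *s e"
  have gG: "g \<in> G" using N(1) g normal_imp_subgroup subgroup.subset by fastforce
  define M where "M = (\<lambda>x. g x - x)"
  have line: "\<exists>c'. (M ^^ j) (c *s e) = c' *s e" for j c
  proof (induction j)
    case (Suc j)
    then obtain c' c'' where "(M ^^ j) (c *s e) = c' *s e" "g (c' *s e) = c'' *s e"
      using G_line[OF gG] by metis
    then have "(M ^^ Suc j) (c *s e) = (c'' - c') *s e"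
      by (simp add: M_def vec.scale_left_diff_distrib)
    then show ?case by blast
  qed simp
  obtain k where "(M ^^ k) (M (c *s e)) = 0" using N(2)[OF g] unfolding unipotent_def M_def by blast
  moreover have "M (c *s e) \<noteq> 0" using neq by (simp add: M_def)
  ultimately obtain j where j: "(M ^^ j) (M (c *s e)) \<noteq> 0" "M ((M ^^ j) (M (c *s e))) = 0"
    using nilpotent_kernel by blast
  \<comment> \<open>The last nonzero iterate: \<open>g\<close> fixes \<open>v\<close>, and
    \<open>v\<close> is itself an image under \<open>M\<close>. Hence some \<open>\<mu> *s v\<close>
    goes to \<open>\<mu> *s v + v\<close>, a nontrivial shear of the real plane.\<close>
  define v where "v = (M ^^ j) (M (c *s e))"
  have v: "v \<noteq> 0" "g v = v" using j by (simp_all add: v_def M_def)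
  obtain p where p: "v = p *s e" using line[of "Suc j" c] by (auto simp: v_def funpow_swap1)
  have p0: "p \<noteq> 0" using v p by auto
  obtain q where q: "(M ^^ j) (c *s e) = q *s e" using line by blast
  have "M (q *s e) = v" by (simp add: v_def funpow_swap1 flip: q)
  define \<mu> where "\<mu> = q / p"
  have "q *s e = \<mu> *s v" using p0 by (simp add: \<mu>_def p)
  then have g\<mu>: "g (\<mu> *s v) = \<mu> *s v + v" using \<open>M (q *s e) = v\<close> by (simp add: M_def algebra_simps)
  have "Im \<mu> \<noteq> 0"
  proof
    assume "Im \<mu> = 0"
    then have "\<mu> *s v = Re \<mu> *\<^sub>R v" by (simp add: scaleR_eq_smult complex_is_Real_iff)
    then have "g (\<mu> *s v) = \<mu> *s v" using v(2) linear_cmul[OF GD(1)[OF gG]] by metis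
    then show False using g\<mu> v(1) by simp
  qed
  \<comment> \<open>In the coordinate \<open>a\<close> of \<open>a *s v\<close> the shear is
    \<open>a \<mapsto> a + l * Im a\<close>, fixing exactly the real \<open>a\<close>.\<close>
  define l where "l = complex_of_real (1 / Im \<mu>)"
  have l0: "l \<noteq> 0" using \<open>Im \<mu> \<noteq> 0\<close> by (simp add: l_def)
  have gv: "g (a *s v) = (a + l * of_real (Im a)) *s v" for a
  proof -
    have "g (a *s v) = (Re a - Im a / Im \<mu> * Re \<mu>) *\<^sub>R v + (Im a / Im \<mu>) *\<^sub>R (\<mu> *s v) + (Im a / Im \<mu>) *\<^sub>R v"
      using linear_on_line[OF GD(1)[OF gG] \<open>Im \<mu> \<noteq> 0\<close>, of a v] by (simp add: v(2) g\<mu> scaleR_add_right)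
    also have "\<dots> = a *s v + (Im a / Im \<mu>) *\<^sub>R v"
      using linear_on_line[OF linear_ident \<open>Im \<mu> \<noteq> 0\<close>, of a v] by simp
    finally show ?thesis by (simp add: scaleR_eq_smult l_def vec.scale_left_distrib mult.commute)
  qed
  obtain z where z: "z \<in> quad_field d" "cmod z = 1" "Im z \<noteq> 0"
    using quad_field_nonreal_unit[OF d_neg] by blast
  have zz: "z * cnj z = 1" using z(2) by (metis complex_norm_square of_real_1 power_one)
  define s where "s = (\<lambda>x :: complex ^ 'n. z *s x)"
  have sG: "s \<in> G" unfolding s_def by (rule scalar_in_G[OF z(1,2)])
  have s'G: "(\<lambda>x. cnj z *s x) \<in> G"
    using z by (intro scalar_in_G quad_field_cnj d_neg) simp_all
  interpret group "comp_group G" by (rule group_G)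
  have "inv\<^bsub>comp_group G\<^esub> s = (\<lambda>x. cnj z *s x)"
    using sG s'G zz by (intro inv_equality) (simp_all add: fun_eq_iff s_def mult.commute)
  then have "s \<circ> g \<circ> (\<lambda>x. cnj z *s x) \<in> N"
    using normal_invE(2)[OF N(1), of s g] sG g by simp
  then have "g \<circ> (s \<circ> g \<circ> (\<lambda>x. cnj z *s x)) \<in> N"
    using subgroup.m_closed[OF normal_imp_subgroup[OF N(1)] g] by simp
  then have unip: "unipotent (\<lambda>x. g (z *s g (cnj z *s x)))"
    using N(2) by (fastforce simp: s_def comp_def)
  define P where "P = (\<lambda>x. g (z *s g (cnj z *s x)) - x)"
  have Pv: "P (a *s v) = (l * of_real (Im (cnj z * a)) * z
      + l * of_real (Im (a + l * of_real (Im (cnj z * a)) * z))) *s v" for a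
  proof -
    define a' where "a' = a + l * of_real (Im (cnj z * a)) * z"
    have "z *s g (cnj z *s (a *s v)) = (z * cnj z * a + l * of_real (Im (cnj z * a)) * z) *s v"
      by (simp add: gv algebra_simps)
    then have "z *s g (cnj z *s (a *s v)) = a' *s v" by (simp add: zz a'_def)
    then have "P (a *s v) = (a' + l * of_real (Im a') - a) *s v"
      by (simp only: P_def gv vec.scale_left_diff_distrib)
    then show ?thesis by (simp only: a'_def add.assoc add_diff_cancel_left')
  qed
  have Pline: "\<exists>a. (P ^^ j) v = a *s v" for j
  proof (induction j)
    case 0
    show ?case by (intro exI[of _ 1]) simp
  next
    case (Suc j)
    then obtain a where "(P ^^ j) v = a *s v" by blast
    then have "(P ^^ Suc j) v = P (a *s v)" by simp
    then show ?case unfolding Pv by blast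
  qed
  obtain k where "(P ^^ k) v = 0" using unip unfolding unipotent_def P_def by blast
  then obtain j where "(P ^^ j) v \<noteq> 0" "P ((P ^^ j) v) = 0" using nilpotent_kernel v(1) by blast
  then obtain a where a: "a *s v \<noteq> 0" "P (a *s v) = 0" using Pline by metis
  \<comment> \<open>A kernel vector of \<open>P\<close> makes \<open>r * z\<close> plus a real
    number vanish, so \<open>r = 0\<close> because \<open>z\<close> is not real. Then
    \<open>a\<close> is real, and \<open>Im (cnj z * a) = 0\<close> leaves only
    \<open>a = 0\<close>.\<close>
  define r where "r = Im (cnj z * a)"
  have "l * of_real r * z + l * of_real (Im (a + l * of_real r * z)) = 0"
    using a(2) v(1) vec.scale_eq_0_iff unfolding Pv r_def[symmetric] by blast
  then have "l * (of_real r * z + of_real (Im (a + l * of_real r * z))) = 0"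
    by (simp only: distrib_left mult.assoc)
  then have 0: "of_real r * z + of_real (Im (a + l * of_real r * z)) = 0" using l0 by simp
  then have "Im (of_real r * z + of_real (Im (a + l * of_real r * z))) = 0" by simp
  then have r0: "r = 0" using z(3) by simp
  with 0 have "Im a = 0" by simp
  with r0 z(3) have "a = 0" by (simp add: r_def complex_eq_iff)
  with a(1) show False by simp
qed

lemma unipotent_radical_eq: "unipotent_radical V G = U"
proof
  show "U \<subseteq> unipotent_radical V G"
    unfolding unipotent_radical_def
    using U_normal U_closed U_connected U_unipotent by blast
  show "unipotent_radical V G \<subseteq> U"
  proof
    fix g assume "g \<in> unipotent_radical V G"
    then obtain N where N: "N \<lhd> comp_group G" "\<And>g. g \<in> N \<Longrightarrow> unipotent g" and g: "g \<in> N"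
      unfolding unipotent_radical_def by blast
    have "g \<in> G" using N(1) g normal_imp_subgroup subgroup.subset by fastforce
    then show "g \<in> U"
      using normal_unipotent_line[OF N g] unipotent_perp[OF _ N(2)[OF g]] by (simp add: U_def)
  qed
qed

subsection \<open>The center\<close>

text \<open>Both sides consist of the maps \<open>transvection s\<close> that preserve
  \<open>V\<close>. These are central because an element of \<open>U\<close> fixes the line
  pointwise and preserves \<open>h x e\<close>.\<close>

lemma center_eq:
  "group_center U = {T \<in> unitary_group h V. T ` J = J \<and> (\<forall>x\<in>V. h x e = 0 \<longrightarrow> T x = x)}"
    (is "_ = ?Z")
proof (intro equalityI subsetI)
  fix z assume "z \<in> group_center U"
  then have z: "z \<in> U" and comm: "\<And>g. g \<in> U \<Longrightarrow> z \<circ> g = g \<circ> z" by (auto simp: group_center_def)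
  note zG = GD[OF UD(1)[OF z]]
  have fixV: "z m = m" if m: "m \<in> V" "h m e = 0" for m
  proof -
    have *: "\<exists>r. z m - m = r *\<^sub>R f" if f: "f \<in> J" "f \<noteq> 0" for f
    proof -
      obtain c where c: "f = c *s e" using J(3)[OF f(1)] by blast
      obtain x where x: "b f x \<noteq> 0" using b_nondegenerate f(2) by blast
      have bfz: "b f (z x) = b f x" using zG(2)[of f x] UD(2)[OF z] c by metis
      have "z (eichler f m 1 x) = eichler f m 1 (z x)"
        using comm[OF eichler_in_U[OF f(1) m]] by (simp add: fun_eq_iff)
      moreover have "z f = f" using UD(2)[OF z] c by simp
      \<comment> \<open>The quadratic terms of \<open>eichler\<close> cancel, since \<open>z\<close>
        fixes \<open>f\<close> and \<open>b f (z x) = b f x\<close>.\<close>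
      ultimately have eq: "b f x *\<^sub>R (z m - m) = (b m x - b m (z x)) *\<^sub>R f"
        by (simp add: eichler_def bfz linear_add[OF zG(1)] linear_diff[OF zG(1)]
            linear_cmul[OF zG(1)] algebra_simps)
      have "z m - m = inverse (b f x) *\<^sub>R (b f x *\<^sub>R (z m - m))" using x by simp
      also have "\<dots> = (inverse (b f x) * (b m x - b m (z x))) *\<^sub>R f"
        by (simp only: eq scaleR_scaleR)
      finally show ?thesis by blast
    qed
    \<comment> \<open>A single \<open>f\<close> confines \<open>z m - m\<close> to a real line. The
      two choices \<open>e\<close> and \<open>csqrt (of_int d) *s e\<close> give real lines that
      meet only in 0.\<close>
    have sJ: "csqrt (of_int d) *s e \<in> J"
      using J(1) e(1) csqrt_in_quad_field by (auto simp: submodule_over_def)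
    moreover have "csqrt (of_int d) *s e \<noteq> 0" using e(2) d_neg by simp
    ultimately obtain r r' where r: "z m - m = r *\<^sub>R e" "z m - m = r' *\<^sub>R (csqrt (of_int d) *s e)"
      using * e by meson
    then have "of_real r *s e = (of_real r' * csqrt (of_int d)) *s e"
      by (metis scaleR_eq_smult vec.scale_scale)
    then have "of_real r = of_real r' * csqrt (of_int d)"
      using e(2) vec.scale_cancel_right by blast
    then have "Im (of_real r) = Im (of_real r' * csqrt (of_int d))" by (rule arg_cong)
    then have "r' = 0" using Im_csqrt_neg[OF d_neg] d_neg by auto
    then show ?thesis using r(2) by simp
  qed
  have "z x = x" if "h x e = 0" for x
  proof -
    have "x \<in> span {x \<in> V. h x e = 0}" using that perp_subset_span by blast
    then show ?thesis
      using linear_eq_on_span[OF zG(1) linear_ident, of "{x \<in> V. h x e = 0}" x] fixV by auto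
  qed
  then obtain s where s: "z = transvection s" using isometry_fixing_perp[OF zG(1,2)] by blast
  have "Vector_Spaces.linear (*s) (*s) z"
    unfolding Vector_Spaces.linear_iff s
    by (auto simp: transvection_def h_simps vec_eq_iff algebra_simps intro: vec.vector_space_axioms)
  then show "z \<in> ?Z" using zG(3,4) fixV by (simp add: unitary_group_def transvection_isometry s)
next
  fix T assume "T \<in> ?Z"
  then have T: "Vector_Spaces.linear (*s) (*s) T" "\<And>x y. h (T x) (T y) = h x y" "T ` V = V"
    "\<And>x. x \<in> V \<Longrightarrow> h x e = 0 \<Longrightarrow> T x = x" by (auto simp: unitary_group_def)
  have lin: "linear T"
    using T(1) by (intro linearI) (auto simp: Vector_Spaces.linear_iff scaleR_eq_smult)
  have "T x = x" if "h x e = 0" for x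
  proof -
    have "x \<in> span {x \<in> V. h x e = 0}" using that perp_subset_span by blast
    then show ?thesis
      using linear_eq_on_span[OF lin linear_ident, of "{x \<in> V. h x e = 0}" x] T(4) by auto
  qed
  then obtain s where s: "T = transvection s"
    using isometry_fixing_perp[OF lin] T(2) by (auto simp: trace_form_def)
  have "transvection (- s) x \<in> V" if "x \<in> V" for x
  proof -
    have "x \<in> T ` V" using that T(3) by simp
    then obtain y where "y \<in> V" "x = transvection s y" unfolding s by auto
    then show ?thesis using transvection_add[of "- s" s y] transvection_zero by simp
  qed
  then have "T \<in> U" using transvection_in_U[of s] T(3) s by blast
  moreover have "T \<circ> g = g \<circ> T" if g: "g \<in> U" for g
  proof
    fix x
    have "g (T x) = g x + g ((\<i> * of_real s * h x e) *s e)"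
      by (simp add: s transvection_def linear_add[OF GD(1)[OF UD(1)[OF g]]])
    then show "(T \<circ> g) x = (g \<circ> T) x"
      by (simp add: s transvection_def U_h[OF g] UD(2)[OF g])
  qed
  ultimately show "T \<in> group_center U" by (simp add: group_center_def)
qed

end

section \<open>Signature\<close>

lemma hermitian_form_sum:
  assumes "hermitian_form h" "finite S"
  shows "h (\<Sum>v\<in>S. u v *s v) y = (\<Sum>v\<in>S. u v * h v y)"
proof -
  have add: "h (x + z) y = h x y + h z y" and smult: "h (c *s x) y = c * h x y" for x z c
    using assms(1) unfolding hermitian_form_def by blast+
  have "h 0 y = 0" using add[of 0 0] by simp
  with assms(2) show ?thesis by (induction S) (simp_all add: add smult)
qed

text \<open>\<open>f\<close> is the unique positive vector of an orthogonal basis; in its complement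
  only negative squares occur.\<close>

lemma has_signature_1:
  assumes h: "hermitian_form h" and "has_signature h 1 n"
  obtains f where "\<And>x. h x f = 0 \<Longrightarrow> 0 \<le> Re (h x x) \<Longrightarrow> x = 0"
proof -
  obtain B where B: "vec.independent B" "vec.span B = UNIV"
      and orth: "\<And>x y. x \<in> B \<Longrightarrow> y \<in> B \<Longrightarrow> x \<noteq> y \<Longrightarrow> h x y = 0"
      and nz: "\<And>x. x \<in> B \<Longrightarrow> h x x \<noteq> 0" and card: "card {x \<in> B. Re (h x x) > 0} = 1"
    using assms(2) unfolding has_signature_def by blast
  obtain f where f: "{x \<in> B. Re (h x x) > 0} = {f}" using card card_1_singletonE by blast
  have sym: "h y x = cnj (h x y)" for x y using h unfolding hermitian_form_def by blast
  have neg: "Re (h v v) < 0" if "v \<in> B" "v \<noteq> f" for v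
  proof -
    have "\<not> Re (h v v) > 0" using f that by blast
    moreover have "Im (h v v) = 0" using arg_cong[OF sym[of v v], of Im] by simp
    then have "Re (h v v) \<noteq> 0" using nz[OF that(1)] by (simp add: complex_eq_iff)
    ultimately show ?thesis by linarith
  qed
  have fin: "finite B" using B(1) vec.finiteI_independent by blast
  have "x = 0" if x: "h x f = 0" "0 \<le> Re (h x x)" for x
  proof -
    have "x \<in> vec.span B" using B(2) by simp
    then obtain u where u: "x = (\<Sum>v\<in>B. u v *s v)" using vec.span_finite[OF fin] by auto
    have coeff: "h x w = u w * h w w" if "w \<in> B" for w
    proof -
      have "h x w = (\<Sum>v\<in>B. u v * h v w)" unfolding u by (rule hermitian_form_sum[OF h fin])
      also have "\<dots> = (\<Sum>v\<in>B. if v = w then u w * h w w else 0)"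
        by (rule sum.cong) (use orth that in auto)
      finally show ?thesis using that fin by simp
    qed
    have "f \<in> B" using f by blast
    then have "u f = 0" using coeff[of f] x(1) nz by simp
    have "h x x = (\<Sum>v\<in>B. u v * h v x)" using hermitian_form_sum[OF h fin, of u x] u by simp
    also have "\<dots> = (\<Sum>v\<in>B. u v * cnj (u v) * h v v)"
    proof (rule sum.cong)
      fix v assume "v \<in> B"
      then have "h v x = cnj (u v) * cnj (h v v)" using sym[of v x] coeff by simp
      then show "u v * h v x = u v * cnj (u v) * h v v" using sym[of v v] by simp
    qed simp
    finally have "Re (h x x) = (\<Sum>v\<in>B. (cmod (u v))^2 * Re (h v v))"
      by (simp add: complex_norm_square[symmetric])
    with x(2) have "(\<Sum>v\<in>B. (cmod (u v))^2 * - Re (h v v)) \<le> 0" by (simp add: sum_negf)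
    moreover have nn: "0 \<le> (cmod (u v))^2 * - Re (h v v)" if "v \<in> B" for v
      using neg[OF that] \<open>u f = 0\<close> by (cases "v = f") (simp_all add: mult_nonneg_nonpos)
    ultimately have "(\<Sum>v\<in>B. (cmod (u v))^2 * - Re (h v v)) = 0"
      by (intro antisym sum_nonneg)
    then have "(cmod (u v))^2 * - Re (h v v) = 0" if "v \<in> B" for v
      using sum_nonneg_eq_0_iff[OF fin, of "\<lambda>v. (cmod (u v))^2 * - Re (h v v)", OF nn] that by blast
    then have "u v = 0" if "v \<in> B" for v
      using neg[OF that] that \<open>u f = 0\<close> by (cases "v = f") force+
    then show "x = 0" using u by simp
  qed
  then show ?thesis using that by blast
qed

text \<open>Subtracting a multiple of \<open>e\<close> keeps \<open>h x x\<close> and can make the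
  vector orthogonal to the positive direction \<open>f\<close>, whose complement is negative
  definite. The same fact applied to \<open>e\<close> shows that \<open>h e f\<close> is
  nonzero.\<close>

lemma has_signature_1_perp_isotropic:
  assumes h: "hermitian_form h" "has_signature h 1 n"
    and e: "h e e = 0" "e \<noteq> 0" and x: "h x e = 0" "0 \<le> Re (h x x)"
  shows "\<exists>c. x = c *s e"
proof -
  obtain f where f: "\<And>x. h x f = 0 \<Longrightarrow> 0 \<le> Re (h x x) \<Longrightarrow> x = 0"
    using has_signature_1[OF h] by blast
  have add: "h (x + y) z = h x z + h y z" and smult: "h (c *s x) y = c * h x y"
    and sym: "h y x = cnj (h x y)" for x y z c using h(1) unfolding hermitian_form_def by blast+
  have "h e f \<noteq> 0" using f[of e] e by auto
  define c where "c = h x f / h e f"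
  let ?y = "x + (- c) *s e"
  have "h ?y f = h x f + (- c) * h e f" by (simp only: add smult)
  then have "h ?y f = 0" using \<open>h e f \<noteq> 0\<close> by (simp add: c_def)
  moreover have "h e x = 0" using sym[of x e] x(1) by simp
  moreover have "h u (v + a *s w) = h u v + cnj a * h u w" for u v w a
  proof -
    have "h u (v + a *s w) = cnj (h v u) + cnj a * cnj (h w u)"
      unfolding sym[of u "v + a *s w"] by (simp add: add smult)
    then show ?thesis by (simp only: sym[of u v, symmetric] sym[of u w, symmetric])
  qed
  then have "h ?y ?y = h x x + (- c) * h e x + cnj (- c) * (h x e + (- c) * h e e)"
    by (simp only: add smult)
  ultimately have "h ?y f = 0" "h ?y ?y = h x x" using x(1) e(1) by simp_all
  then have "?y = 0" using f[of ?y] x(2) by metis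
  then show ?thesis by (intro exI[of _ c]) simp
qed

section \<open>Rational spans\<close>

lemma submodule_over_hull: "submodule_over R (submodule_over R hull M)"
  by (rule hull_in) (auto simp: submodule_over_def)

lemma csqrt_in_quad_integers: "csqrt (of_int d) \<in> quad_integers d"
  by (simp add: quad_integers_def csqrt_in_quad_field algebraic_int_csqrt int_imp_algebraic_int)

text \<open>The generator \<open>csqrt (of_int d)\<close> of the field is an algebraic integer, so
  it acts on the rational span. This identifies the ambient spaces in the unitary and the orthogonal
  definition of the center.\<close>

lemma hull_Rats_quad_field:
  assumes "submodule_over (quad_integers d) M"
  shows "submodule_over (quad_field d) (submodule_over \<rat> hull M)"
    and "submodule_over (quad_field d) hull M = submodule_over \<rat> hull M"
proof -
  let ?H = "submodule_over \<rat> hull M" and ?s = "csqrt (of_int d)"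
  have H: "0 \<in> ?H" "\<And>x y. x \<in> ?H \<Longrightarrow> y \<in> ?H \<Longrightarrow> x + y \<in> ?H" "\<And>r x. r \<in> \<rat> \<Longrightarrow> x \<in> ?H \<Longrightarrow> r *s x \<in> ?H"
    using submodule_over_hull[of \<rat> M] by (auto simp: submodule_over_def)
  have MH: "M \<subseteq> ?H" by (rule hull_subset)
  have "(?s * r) *s x \<in> ?H" if "r \<in> \<rat>" "?s *s x \<in> ?H" for r x
    using H(3)[OF that] by (simp add: mult.commute)
  then have "submodule_over \<rat> {x \<in> ?H. ?s *s x \<in> ?H}"
    using H by (auto simp: submodule_over_def vector_add_ldistrib)
  moreover have "M \<subseteq> {x \<in> ?H. ?s *s x \<in> ?H}"
    using MH assms csqrt_in_quad_integers unfolding submodule_over_def by blast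
  ultimately have s: "?s *s x \<in> ?H" if "x \<in> ?H" for x
    using hull_minimal[of M "{x \<in> ?H. ?s *s x \<in> ?H}" "submodule_over \<rat>"] that by blast
  have "c *s x \<in> ?H" if c: "c \<in> quad_field d" and x: "x \<in> ?H" for c x
  proof -
    obtain p q where "c = of_rat p + of_rat q * ?s" using c unfolding quad_field_def by blast
    then have "c *s x = of_rat p *s x + of_rat q *s (?s *s x)" by (simp add: vector_sadd_rdistrib)
    moreover have "of_rat p *s x \<in> ?H" "of_rat q *s (?s *s x) \<in> ?H"
      using H(3)[OF Rats_of_rat x] H(3)[OF Rats_of_rat s[OF x]] by blast+
    ultimately show ?thesis using H(2) by metis
  qed
  then show F: "submodule_over (quad_field d) ?H"
    using H(1,2) by (simp add: submodule_over_def)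
  have "submodule_over \<rat> (submodule_over (quad_field d) hull M)"
    using submodule_over_hull[of "quad_field d" M] quad_field_Rats by (auto simp: submodule_over_def)
  then show "submodule_over (quad_field d) hull M = ?H"
    by (intro equalityI hull_minimal F hull_subset)
qed

text \<open>The hull is minimal in one argument at a time; Hermitian symmetry swaps the arguments in
  between.\<close>

lemma hull_Rats_form_values:
  assumes "hermitian_form h" "d < 0" "\<And>x y. x \<in> L \<Longrightarrow> y \<in> L \<Longrightarrow> h x y \<in> quad_field d"
    and "x \<in> submodule_over \<rat> hull L" "y \<in> submodule_over \<rat> hull L"
  shows "h x y \<in> quad_field d"
proof -
  have add: "h (x + y) z = h x z + h y z" and smult: "h (c *s x) y = c * h x y" for x y z c
    using assms(1) unfolding hermitian_form_def by blast+
  have zero: "h 0 y = 0" for y using add[of 0 0 y] by simp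
  have sub: "submodule_over \<rat> {x. \<forall>y\<in>S. h x y \<in> quad_field d}" for S
    using quad_field_Rats quad_field_add quad_field_mult
    by (auto simp: submodule_over_def add smult zero)
  have sym: "h y x \<in> quad_field d" if "h x y \<in> quad_field d" for x y
    using quad_field_cnj[OF assms(2) that] assms(1) unfolding hermitian_form_def by metis
  let ?H = "submodule_over \<rat> hull L"
  have "?H \<subseteq> {x. \<forall>y\<in>L. h x y \<in> quad_field d}"
    using assms(3) by (intro hull_minimal sub) blast
  then have "?H \<subseteq> {x. \<forall>y\<in>?H. h x y \<in> quad_field d}"
    using sym by (intro hull_minimal sub) blast
  then show ?thesis using assms(4,5) by blast
qed

section \<open>Cusps as isotropic lines, and equality of the two centers\<close>

lemma unitary_cusp_generator:
  assumes "unitary_cusp d h L I"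
  obtains e where "e \<in> I" "e \<noteq> 0" "h e e = 0" "\<And>x. x \<in> I \<Longrightarrow> \<exists>c. x = c *s e"
proof -
  have dim: "vec.dim I = 1" and iso: "\<And>x y. x \<in> I \<Longrightarrow> y \<in> I \<Longrightarrow> h x y = 0"
    using assms by (auto simp: unitary_cusp_def)
  have "\<not> I \<subseteq> {0}"
    using dim vec.dim_subset[of I "{0}"] vec.dim_le_card[of I "{}"] by auto
  then obtain e where e: "e \<in> I" "e \<noteq> 0" by blast
  then have "I \<subseteq> vec.span {e}"
    using dim by (intro vec.card_ge_dim_independent) auto
  then have "\<exists>c. x = c *s e" if "x \<in> I" for x
    using that vec.span_singleton[of e] by auto
  then show ?thesis using that e iso by blast
qed

lemma unitary_cusp_isotropic_line:
  assumes "d < 0" "hermitian_lattice d h L" "has_signature h 1 n" "D \<in> domain_components (trace_form h)"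
    and "unitary_cusp d h L I"
    and e: "e \<in> I" "e \<noteq> 0" "h e e = 0" "\<And>x. x \<in> I \<Longrightarrow> \<exists>c. x = c *s e"
  shows "isotropic_line d h (submodule_over \<rat> hull L) (submodule_over \<rat> hull I) D e"
proof
  have h: "hermitian_form h" and L: "submodule_over (quad_integers d) L"
    and hL: "\<And>x y. x \<in> L \<Longrightarrow> y \<in> L \<Longrightarrow> \<exists>a\<in>quad_integers d. h x y = kappa d * a"
    using assms(2) by (auto simp: hermitian_lattice_def)
  have I: "submodule_over (quad_integers d) I" "I \<subseteq> L" using assms(5) by (auto simp: unitary_cusp_def)
  show "d < 0" "hermitian_form h" "h e e = 0" "e \<noteq> 0" "D \<in> domain_components (trace_form h)"
    by fact+
  obtain f where f: "\<And>x. h x f = 0 \<Longrightarrow> 0 \<le> Re (h x x) \<Longrightarrow> x = 0"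
    using has_signature_1[OF h assms(3)] by blast
  show "x = 0" if "\<And>y. h x y = 0" for x using f that by simp
  show "\<exists>c. x = c *s e" if "h x e = 0" "0 \<le> Re (h x x)" for x
    using has_signature_1_perp_isotropic[OF h assms(3) e(3,2) that] .
  show "e \<in> submodule_over \<rat> hull I" using e(1) by (rule hull_inc)
  show "submodule_over (quad_field d) (submodule_over \<rat> hull I)"
    "submodule_over (quad_field d) (submodule_over \<rat> hull L)"
    using hull_Rats_quad_field(1)[OF I(1)] hull_Rats_quad_field(1)[OF L] by simp_all
  show "submodule_over \<rat> hull I \<subseteq> submodule_over \<rat> hull L" using I(2) by (rule hull_mono)
  have "submodule_over \<rat> (vec.span {e})"
    by (simp add: submodule_over_def vec.span_zero vec.span_add vec.span_scale)
  moreover have "I \<subseteq> vec.span {e}" using e(4) by (auto simp: vec.span_singleton)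
  ultimately have "submodule_over \<rat> hull I \<subseteq> vec.span {e}" by (metis hull_minimal)
  then show "\<exists>c. x = c *s e" if "x \<in> submodule_over \<rat> hull I" for x
    using that by (auto simp: vec.span_singleton)
  obtain B where "span B = UNIV" "L = submodule_over \<int> hull B"
    using assms(2) by (auto simp: hermitian_lattice_def)
  then have "B \<subseteq> submodule_over \<rat> hull L" by (meson hull_subset subset_trans)
  from span_mono[OF this] show "span (submodule_over \<rat> hull L) = UNIV"
    using \<open>span B = UNIV\<close> by auto
  show "h x y \<in> quad_field d" if "x \<in> submodule_over \<rat> hull L" "y \<in> submodule_over \<rat> hull L" for x y
    using h \<open>d < 0\<close> _ that
  proof (rule hull_Rats_form_values)
    fix x y assume "x \<in> L" "y \<in> L"
    then obtain a where a: "a \<in> quad_integers d" "h x y = kappa d * a" using hL by blast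
    have "2 * csqrt (of_int d) \<in> quad_field d"
      by (intro quad_field_mult quad_field_Rats csqrt_in_quad_field) simp
    then have "kappa d \<in> quad_field d"
      using quad_field_inverse[OF \<open>d < 0\<close>] csqrt_in_quad_field[of d]
      by (simp only: kappa_def inverse_eq_divide[symmetric] split: if_splits) simp
    then show "h x y \<in> quad_field d" using a by (simp add: quad_integers_def quad_field_mult)
  qed
qed

lemma Z_unitary_eq_Z_orthogonal:
  assumes "d < 0" "hermitian_lattice d h L" "has_signature h 1 n" "D \<in> domain_components (trace_form h)"
    and "unitary_cusp d h L I"
  shows "Z_unitary d h L I = Z_orthogonal (trace_form h) D L I"
proof -
  obtain e where gen: "e \<in> I" "e \<noteq> 0" "h e e = 0" "\<And>x. x \<in> I \<Longrightarrow> \<exists>c. x = c *s e"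
    using unitary_cusp_generator[OF assms(5)] by blast
  interpret isotropic_line d h "submodule_over \<rat> hull L" "submodule_over \<rat> hull I" D e
    by (rule unitary_cusp_isotropic_line[OF assms gen])
  have "submodule_over (quad_integers d) L" "submodule_over (quad_integers d) I"
    using assms(2,5) by (auto simp: hermitian_lattice_def unitary_cusp_def)
  note hull = this[THEN hull_Rats_quad_field(2)]
  have "(\<forall>y\<in>I. h x y = 0) \<longleftrightarrow> h x e = 0" for x
  proof
    assume "h x e = 0"
    then show "\<forall>y\<in>I. h x y = 0" using gen(4) by (metis h_smult_right mult_zero_right)
  qed (use gen(1) in blast)
  then show ?thesis
    unfolding Z_unitary_def Z_orthogonal_def Let_def hull G_def[symmetric] unipotent_radical_eq center_eq
    by simp
qed

text \<open>Rank 2 comes from the real basis \<open>e\<close>, \<open>csqrt (of_int d) *s e\<close>.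
  Primitivity over \<int> is inherited because \<int> lies in the ring of integers.\<close>

lemma unitary_cusp_orthogonal_cusp:
  assumes "d < 0" "unitary_cusp d h L I"
  shows "orthogonal_cusp (trace_form h) L I"
proof -
  obtain e where e: "e \<in> I" "e \<noteq> 0" "\<And>x. x \<in> I \<Longrightarrow> \<exists>c. x = c *s e"
    using unitary_cusp_generator[OF assms(2)] by blast
  have I: "I \<subseteq> L" "submodule_over (quad_integers d) I" "primitive_in (quad_integers d) L I"
    "\<And>x y. x \<in> I \<Longrightarrow> y \<in> I \<Longrightarrow> h x y = 0" using assms(2) by (auto simp: unitary_cusp_def)
  have Z: "\<int> \<subseteq> quad_integers d"
    using quad_field_Rats Ints_subset_Rats int_imp_algebraic_int by (auto simp: quad_integers_def)
  let ?s = "csqrt (of_int d)"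
  have s: "Im ?s \<noteq> 0" using Im_csqrt_neg[OF assms(1)] by simp
  have "?s *s e \<in> I" using I(2) e(1) csqrt_in_quad_integers by (auto simp: submodule_over_def)
  moreover have neq: "e \<noteq> r *\<^sub>R (?s *s e)" for r
  proof
    assume "e = r *\<^sub>R (?s *s e)"
    then have "1 *s e = (of_real r * ?s) *s e" by (simp add: scaleR_eq_smult)
    then have "1 = of_real r * ?s" using e(2) vec.scale_cancel_right by blast
    then have "Re 1 = Re (of_real r * ?s)" by (rule arg_cong)
    then show False using assms(1) by (simp add: csqrt_of_neg_int)
  qed
  have "?s *s e \<noteq> 0" using e(2) s by auto
  then have "independent {e, ?s *s e}" using neq by (auto simp: independent_insert span_singleton)
  moreover have "I \<subseteq> span {e, ?s *s e}"
  proof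
    fix x assume "x \<in> I"
    then obtain c where "x = c *s e" using e(3) by blast
    then have "x = (Re c - Im c / Im ?s * Re ?s) *\<^sub>R e + (Im c / Im ?s) *\<^sub>R (?s *s e)"
      unfolding scaleR_eq_smult vec.scale_scale vec.scale_left_distrib[symmetric]
      using complex_real_combination[OF s, of c] by simp
    then show "x \<in> span {e, ?s *s e}"
      by (simp add: span_add span_scale span_base)
  qed
  moreover have "card {e, ?s *s e} = 2" using neq[of 1] by simp
  ultimately have "dim I = 2" using e(1) by (intro dim_unique[of "{e, ?s *s e}"]) auto
  then show ?thesis
    using I Z unfolding orthogonal_cusp_def submodule_over_def primitive_in_def trace_form_def by auto
qed

section \<open>Scalar multiples of elements of the center\<close>

text \<open>Elements of \<open>Z\<close> are complex linear, so the scalars move to the front.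
  Powers of one scaled element thus decide between the types.\<close>

lemma has_scaled_mult:
  assumes \<Gamma>: "\<And>f g. f \<in> \<Gamma> \<Longrightarrow> g \<in> \<Gamma> \<Longrightarrow> f \<circ> g \<in> \<Gamma>"
    and Z: "\<And>f g. f \<in> Z \<Longrightarrow> g \<in> Z \<Longrightarrow> f \<circ> g \<in> Z" "\<And>f c x. f \<in> Z \<Longrightarrow> f (c *s x) = c *s f x"
    and "has_scaled \<Gamma> Z a" "has_scaled \<Gamma> Z c"
  shows "has_scaled \<Gamma> Z (a * c)"
proof -
  obtain S T where S: "S \<in> Z" "(\<lambda>x. a *s S x) \<in> \<Gamma>" and T: "T \<in> Z" "(\<lambda>x. c *s T x) \<in> \<Gamma>"
    using assms(4,5) unfolding has_scaled_def by blast
  have "(\<lambda>x. a *s S x) \<circ> (\<lambda>x. c *s T x) = (\<lambda>x. (a * c) *s (S \<circ> T) x)"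
    by (simp add: fun_eq_iff Z(2)[OF S(1)])
  then show ?thesis
    unfolding has_scaled_def using \<Gamma>[OF S(2) T(2)] Z(1)[OF S(1) T(1)] by (intro bexI[of _ "S \<circ> T"]) simp_all
qed

lemma unitary_group_compose:
  assumes "f \<in> unitary_group h M" "g \<in> unitary_group h M"
  shows "f \<circ> g \<in> unitary_group h M"
proof -
  have "f ` M = M" "g ` M = M" using assms by (auto simp: unitary_group_def)
  then have "(f \<circ> g) ` M = M" by (simp only: image_comp[symmetric])
  then show ?thesis using assms by (simp add: unitary_group_def Vector_Spaces.linear_iff)
qed

lemma Z_unitary_compose:
  assumes "f \<in> Z_unitary d h L I" "g \<in> Z_unitary d h L I"
  shows "f \<circ> g \<in> Z_unitary d h L I"
proof -
  let ?I = "submodule_over (quad_field d) hull I"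
  have "f ` ?I = ?I" "g ` ?I = ?I" using assms by (simp_all add: Z_unitary_def Let_def)
  then have "(f \<circ> g) ` ?I = ?I" by (simp only: image_comp[symmetric])
  then show ?thesis using assms by (simp add: Z_unitary_def Let_def unitary_group_compose)
qed

text \<open>Members of \<open>\<Gamma>\<close> preserve \<open>L\<close>, and a scalar of modulus 1
  keeps \<open>T\<close> unitary. Hence nothing of the form \<open>c T\<close> is lost in the
  restriction, even when \<open>T\<close> is only known to preserve a larger space such as the
  rational one.\<close>

lemma unitary_restriction_scalar_multiple:
  assumes \<Gamma>: "\<Gamma> \<subseteq> orthogonal_plus b D L" and h: "hermitian_form h"
    and T: "T \<in> unitary_group h M" and c: "cmod c = 1"
  shows "(\<lambda>x. c *s T x) \<in> unitary_restriction h L \<Gamma> \<longleftrightarrow> (\<lambda>x. c *s T x) \<in> \<Gamma>"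
proof -
  have "(\<lambda>x. c *s T x) ` L = L" if "(\<lambda>x. c *s T x) \<in> \<Gamma>"
    using \<Gamma> that by (auto simp: orthogonal_plus_def orthogonal_group_def)
  moreover have "h (c *s T x) (c *s T y) = h x y" for x y
  proof -
    have smult: "h (a *s u) v = a * h u v" and sym: "h v u = cnj (h u v)" for a u v
      using h unfolding hermitian_form_def by blast+
    have "h u (a *s v) = cnj a * h u v" for a u v
      using sym[of u "a *s v"] sym[of u v] by (simp add: smult)
    then have "h (c *s T x) (c *s T y) = (c * cnj c) * h (T x) (T y)" by (simp add: smult)
    moreover have "c * cnj c = 1" using c by (metis complex_norm_square of_real_1 power_one)
    ultimately show ?thesis using T by (simp add: unitary_group_def)
  qed
  moreover have "Vector_Spaces.linear (*s) (*s) (\<lambda>x. c *s T x)"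
    using T by (simp add: unitary_group_def Vector_Spaces.linear_iff vector_add_ldistrib mult.commute)
  ultimately show ?thesis by (auto simp: unitary_restriction_def unitary_group_def)
qed

lemma orthogonal_irregular_iff:
  assumes \<Gamma>: "\<Gamma> \<subseteq> orthogonal_plus b D L" and h: "hermitian_form h"
    and Z: "Z_unitary d h L I = Z_orthogonal b D L I"
  defines "\<Gamma>\<^sub>U \<equiv> unitary_restriction h L \<Gamma>"
  shows "orthogonal_irregular b D L \<Gamma> I \<longleftrightarrow>
    \<not> has_scalar \<Gamma>\<^sub>U (-1) \<and> has_scaled \<Gamma>\<^sub>U (Z_unitary d h L I) (-1)"
proof -
  have "(\<lambda>x. (-1) *s T x) \<in> \<Gamma>\<^sub>U \<longleftrightarrow> (\<lambda>x. - T x) \<in> \<Gamma>" if "T \<in> unitary_group h M" for T M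
    using unitary_restriction_scalar_multiple[OF \<Gamma> h that, of "-1"] by (simp add: \<Gamma>\<^sub>U_def)
  moreover have "(\<lambda>x. x) \<in> unitary_group h UNIV"
    by (simp add: unitary_group_def Vector_Spaces.linear_iff vec.vector_space_axioms)
  moreover have "T \<in> unitary_group h (submodule_over (quad_field d) hull L)"
    if "T \<in> Z_unitary d h L I" for T using that by (simp add: Z_unitary_def Let_def)
  ultimately show ?thesis
    unfolding orthogonal_irregular_def has_scalar_def has_scaled_def Z[symmetric] by blast
qed

theorem proposition1p3:
  fixes d :: int and n :: nat and \<omega> :: complex
    and h :: "complex ^ 'n \<Rightarrow> complex ^ 'n \<Rightarrow> complex"
    and L I :: "(complex ^ 'n) set"
    and D :: "((complex ^ 'n) \<times> (complex ^ 'n)) set set"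
    and \<Gamma>\<^sub>O \<Gamma>\<^sub>U :: "(complex ^ 'n \<Rightarrow> complex ^ 'n) set"
  assumes "d < 0" and "squarefree d"
    and "\<omega> ^ 3 = 1" and "\<omega> \<noteq> 1"
    and "hermitian_lattice d h L" and "has_signature h 1 n" and "n > 1"
    and "D \<in> domain_components (trace_form h)"
    and "finite_index_subgroup \<Gamma>\<^sub>O (orthogonal_plus (trace_form h) D L)"
    and "\<Gamma>\<^sub>U = unitary_restriction h L \<Gamma>\<^sub>O"
    and "unitary_cusp d h L I"
  shows "orthogonal_cusp (trace_form h) L I \<and>
    (unitary_regular d \<omega> h L \<Gamma>\<^sub>U I \<longrightarrow> orthogonal_regular (trace_form h) D L \<Gamma>\<^sub>O I) \<and>
    (d \<noteq> -1 \<and> d \<noteq> -3 \<longrightarrow>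
      (unitary_irregular d \<omega> h L \<Gamma>\<^sub>U 2 I \<longrightarrow> orthogonal_irregular (trace_form h) D L \<Gamma>\<^sub>O I)) \<and>
    (d = -1 \<longrightarrow>
      (unitary_irregular d \<omega> h L \<Gamma>\<^sub>U 2 I \<or> unitary_irregular d \<omega> h L \<Gamma>\<^sub>U 4 I \<longrightarrow>
         orthogonal_irregular (trace_form h) D L \<Gamma>\<^sub>O I) \<and>
      (unitary_semi_irregular d \<omega> h L \<Gamma>\<^sub>U 2 I \<longrightarrow> orthogonal_regular (trace_form h) D L \<Gamma>\<^sub>O I)) \<and>
    (d = -3 \<longrightarrow>
      (unitary_irregular d \<omega> h L \<Gamma>\<^sub>U 2 I \<or> unitary_irregular d \<omega> h L \<Gamma>\<^sub>U 6 I \<or>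
         unitary_semi_irregular d \<omega> h L \<Gamma>\<^sub>U 2 I \<longrightarrow>
         orthogonal_irregular (trace_form h) D L \<Gamma>\<^sub>O I) \<and>
      (unitary_irregular d \<omega> h L \<Gamma>\<^sub>U 3 I \<or> unitary_semi_irregular d \<omega> h L \<Gamma>\<^sub>U 3 I \<longrightarrow>
         orthogonal_regular (trace_form h) D L \<Gamma>\<^sub>O I))"
proof -
  have h: "hermitian_form h" using assms(5) by (simp add: hermitian_lattice_def)
  define Z where "Z = Z_unitary d h L I"
  have "subgroup \<Gamma>\<^sub>O (comp_group (orthogonal_plus (trace_form h) D L))"
    using assms(9) by (simp add: finite_index_subgroup_def)
  then have \<Gamma>: "\<Gamma>\<^sub>O \<subseteq> orthogonal_plus (trace_form h) D L"
      and comp: "\<And>f g. f \<in> \<Gamma>\<^sub>O \<Longrightarrow> g \<in> \<Gamma>\<^sub>O \<Longrightarrow> f \<circ> g \<in> \<Gamma>\<^sub>O"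
    using subgroup.subset subgroup.m_closed by fastforce+
  have cusp: "orthogonal_cusp (trace_form h) L I"
    using unitary_cusp_orthogonal_cusp assms(1,11) by blast
  have "Z_unitary d h L I = Z_orthogonal (trace_form h) D L I"
    using Z_unitary_eq_Z_orthogonal assms(1,5,6,8,11) by blast
  then have irr: "orthogonal_irregular (trace_form h) D L \<Gamma>\<^sub>O I \<longleftrightarrow>
      \<not> has_scalar \<Gamma>\<^sub>U (-1) \<and> has_scaled \<Gamma>\<^sub>U Z (-1)"
    unfolding assms(10) Z_def by (rule orthogonal_irregular_iff[OF \<Gamma> h])
  have mult: "has_scaled \<Gamma>\<^sub>U Z (a * c)" if "has_scaled \<Gamma>\<^sub>U Z a" "has_scaled \<Gamma>\<^sub>U Z c" for a c
  proof (rule has_scaled_mult[OF _ _ _ that])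
    show "f \<circ> g \<in> \<Gamma>\<^sub>U" if "f \<in> \<Gamma>\<^sub>U" "g \<in> \<Gamma>\<^sub>U" for f g
      using that comp by (simp add: assms(10) unitary_restriction_def unitary_group_compose)
    show "f \<circ> g \<in> Z" if "f \<in> Z" "g \<in> Z" for f g using that Z_unitary_compose by (simp add: Z_def)
    show "f (k *s x) = k *s f x" if "f \<in> Z" for f k x
      using that by (simp add: Z_def Z_unitary_def Let_def unitary_group_def Vector_Spaces.linear_iff)
  qed
  \<comment> \<open>Powers equal to -1 are what matters: the square of \<open>- \<i>\<close> here
    and the cube of \<open>- \<omega>\<close> next. Index 4 or 6 therefore entails some
    \<open>- T\<close> in the group.\<close>
  have i: "has_scaled \<Gamma>\<^sub>U Z (-1)" if "has_scaled \<Gamma>\<^sub>U Z (- \<i>)"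
    using mult[OF that that] by simp
  have \<omega>: "has_scaled \<Gamma>\<^sub>U Z (-1)" if "has_scaled \<Gamma>\<^sub>U Z (- \<omega>)"
    using mult[OF that mult[OF that that]] assms(3) by (simp add: power3_eq_cube mult.assoc)
  \<comment> \<open>For index 3 irregularity, which excludes index 6, this rules out every
    \<open>- T\<close> and so makes the orthogonal cusp regular.\<close>
  have \<omega>': "has_scaled \<Gamma>\<^sub>U Z (- \<omega>)" if "has_scaled \<Gamma>\<^sub>U Z \<omega>" "has_scaled \<Gamma>\<^sub>U Z (-1)"
    using mult[OF that] by simp
  note types = orthogonal_regular_def irr unitary_irregular_def unitary_semi_irregular_def
    unitary_irregular_4_def unitary_irregular_6_def Let_def Z_def[symmetric]
  have "orthogonal_regular (trace_form h) D L \<Gamma>\<^sub>O I" if "unitary_regular d \<omega> h L \<Gamma>\<^sub>U I"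
  proof -
    have "\<not> unitary_irregular d \<omega> h L \<Gamma>\<^sub>U m I" "\<not> unitary_semi_irregular d \<omega> h L \<Gamma>\<^sub>U m I" for m
      using that by (simp_all add: unitary_regular_def)
    \<comment> \<open>These types exhaust the case where \<open>-id\<close> is missing and some
      \<open>- T\<close> is present: irregular of index 2 in general, of index 2 or 4 for
      \<open>d = -1\<close>, and of index 2 or 6 or semi-irregular of index 2 for
      \<open>d = -3\<close>.\<close>
    from this(1)[of 2] this(1)[of 4] this(1)[of 6] this(2)[of 2] show ?thesis
      unfolding types by auto
  qed
  \<comment> \<open>In the semi-irregular cases with \<open>d = -1\<close> or with index 3,
    \<open>-id\<close> is in the group, so the orthogonal cusp is regular at once.\<close>
  with cusp show ?thesis unfolding types using i \<omega> \<omega>' by auto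
qed

end
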